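(* Let $F$ be a bivariate distribution function with marginals $F_1,F_2$, which is not the distribution function of an almost surely constant random vector. Suppose that the set $\{F>0\}\subset\mathbb{R}^2$ is a generalized rectangle with lower corner $\mathbf{L}=(L_1,L_2)=\inf\mathrm{supp}(F)\in\mathbb{R}^2$. Define on $\{F>0\}$ $$Q_F(\mathbf{x})=\frac{F_1(x_1)F_2(x_2)}{F(\mathbf{x})},\qquad T_F(\mathbf{x})=\frac{F_1(x_1)F_2(x_2)}{F(\mathbf{x})}-F_1(x_1)-F_2(x_2)+1 .$$ Then the following are equivalent. (1) $F$ is bi-freely max-infinitely divisible. (2) The function $-Q_F$ is quasi-monotone on $\{F>0\}$, and for all $\mathbf{x}\le\mathbf{y}$ in $\{F>0\}$, $$0\le Q_F(\mathbf{y})-Q_F(\mathbf{x})\le F_1(y_1)-F_1(x_1)+F_2(y_2)-F_2(x_2).$$ (3) The function $-T_F$ is increasing, continuous from above, and quasi-monotone on $\{F>0\}$. (4) There exist a distribution function $H$ on $\mathbb{R}^2$ and a finite number $\lambda>0$ such that $T_F=\lambda(1-H)$ holds on $\{F>0\}$. (5) There exists a positive Borel measure $\tau\ne0$ on $\mathbb{R}^2$, with marginals $\tau_1,\tau_2$, such that $1-F_j(x)=\tau_j((x,\infty))$ for all $x>L_j$, $j=1,2$, and $$F(\mathbf{x})=\frac{F_1(x_1)F_2(x_2)}{1-\tau\big((x_1,\infty)\times(x_2,\infty)\big)}\quad\text{for all }\mathbf{x}\in(L_1,\infty)\times(L_2,\infty).$$ Let $\nu$ be the probability measure having distribution function $H$.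 If (1)-(5) hold, then $\tau=\lambda\nu$, and $T_F$ has an extension to $[L_1,\infty)\times[L_2,\infty)$ such that $T_F=\lambda(1-H)$ holds on $[L_1,\infty)\times[L_2,\infty)$ and $0<T_F(\mathbf{L})\le\lambda$.
   Context: Vectors: $\mathbf{x}=(x_1,x_2)\in\mathbb{R}^2$, and $\mathbf{x}\le\mathbf{y}$ means $x_j\le y_j$ for $j=1,2$. A bivariate distribution function is $F(\mathbf{x})=\mu((-\infty,x_1]\times(-\infty,x_2])$ for a Borel probability measure $\mu$ on $\mathbb{R}^2$; $F_1,F_2$ denote its marginal distribution functions. $c_+=\max\{c,0\}$. Bi-free max-convolution: for bivariate distribution functions $F,G$, $H=F\star G$ is the (unique) bivariate distribution function with marginals $H_j=(F_j+G_j-1)_+$ on $\mathbb{R}$, $j=1,2$, and such that $\frac{H_1H_2}{H}=\frac{F_1F_2}{F}+\frac{G_1G_2}{G}-1$ at each $\mathbf{x}$ where $F(\mathbf{x}),G(\mathbf{x}),H_1(x_1),H_2(x_2)$ are all strictly positive, and $H(\mathbf{x})=0$ at all other $\mathbf{x}$. The operation is well defined, commutative and associative; $F^{\star n}$ is the $n$-fold convolution of $F$ with itself. $F$ is bi-freely max-infinitely divisible if for every $n\in\mathbb{N}$ there is a bivariate distribution function $F^{(1/n)}$ with $(F^{(1/n)})^{\star n}=F$. A generalized rectangle with lower corner $\mathbf{L}=(L_1,L_2)\in\mathbb{R}^2$ is one of $(L_1,\infty)\times(L_2,\infty)$, $(L_1,\infty)\times[L_2,\infty)$, $[L_1,\infty)\times(L_2,\infty)$,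 $[L_1,\infty)\times[L_2,\infty)$. If $\{F>0\}$ is such a set, $\inf\mathrm{supp}(F)$ denotes $\mathbf{L}$. A real function $K$ on $\mathcal{S}\subset\mathbb{R}^2$ is quasi-monotone if $K(y_1,y_2)-K(x_1,y_2)-K(y_1,x_2)+K(x_1,x_2)\ge0$ whenever $[x_1,y_1]\times[x_2,y_2]\subset\mathcal{S}$; increasing if $K(\mathbf{x})\le K(\mathbf{y})$ whenever $\mathbf{x}\le\mathbf{y}$ in $\mathcal S$; continuous from above if $K(\mathbf{y})\to K(\mathbf{x})$ as $\mathbf{y}\to\mathbf{x}$ with $\mathbf{y}\ge\mathbf{x}$ in $\mathcal S$. In the last assertion, $H,\lambda$ are those of (4) and $\tau$ is that of (5).
   Formalization: "τ=λν" fails for arbitrary choices (mass at or below L is not determined); proved instead: each λν is a τ of (5), each finite τ is some λν, any τ and λν agree on Borel sets in (L1,∞)×(L2,∞), and τ=λν if both live on the closed quadrant with equal total mass. *)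

theory Defs
  imports "HOL-Probability.Probability"
begin

text \<open>The order on \<open>real \<times> real\<close> is the componentwise one (HOL-Library.Product_Order).\<close>

definition is_df_of :: "(real \<times> real) measure \<Rightarrow> (real \<times> real \<Rightarrow> real) \<Rightarrow> bool" where
  "is_df_of \<mu> F \<longleftrightarrow> prob_space \<mu> \<and> sets \<mu> = sets borel \<and>
     (\<forall>x. F x = measure \<mu> ({..fst x} \<times> {..snd x}))"

definition bivariate_df :: "(real \<times> real \<Rightarrow> real) \<Rightarrow> bool" where
  "bivariate_df F \<longleftrightarrow> (\<exists>\<mu>. is_df_of \<mu> F)"

definition df_measure :: "(real \<times> real \<Rightarrow> real) \<Rightarrow> (real \<times> real) measure" where
  "df_measure F = (THE \<mu>. is_df_of \<mu> F)"

lemma is_df_of_unique: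
  assumes "is_df_of \<mu> F" "is_df_of \<nu> F"
  shows "\<mu> = \<nu>"
proof (rule measure_eqI_generator_eq[where \<Omega> = UNIV and E = "range (\<lambda>x. {..x})"
      and A = "\<lambda>n. {..(real n, real n)}"])
  interpret M: prob_space \<mu> using assms(1) by (simp add: is_df_of_def)
  interpret N: prob_space \<nu> using assms(2) by (simp add: is_df_of_def)
  have split: "{..x} = {..fst x} \<times> {..snd x}" for x :: "real \<times> real"
    by (auto simp: less_eq_prod_def)
  show "Int_stable (range (\<lambda>x::real \<times> real. {..x}))"
  proof (clarsimp simp: Int_stable_def)
    fix a b c d :: real
    have "{..(a, b)} \<inter> {..(c, d)} = {..(min a c, min b d)}"
      by (auto simp: less_eq_prod_def)
    then show "{..(a, b)} \<inter> {..(c, d)} \<in> range atMost" by simp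
  qed
  show "\<And>X. X \<in> range (\<lambda>x. {..x}) \<Longrightarrow> emeasure \<mu> X = emeasure \<nu> X"
    using assms by (auto simp: is_df_of_def M.emeasure_eq_measure N.emeasure_eq_measure split)
  show "sets \<mu> = sigma_sets UNIV (range (\<lambda>x. {..x}))" "sets \<nu> = sigma_sets UNIV (range (\<lambda>x. {..x}))"
    using assms by (auto simp: is_df_of_def borel_eq_atMost)
  have "\<exists>n. z \<le> (real n, real n)" for z :: "real \<times> real"
    using real_arch_simple[of "max (fst z) (snd z)"] by (auto simp: less_eq_prod_def)
  then show "(\<Union>n. {..(real n, real n)}) = UNIV" by auto
  show "emeasure \<mu> {..(real n, real n)} \<noteq> \<infinity>" for n
    by (simp add: M.emeasure_eq_measure)
qed auto

lemma df_measure_eq: "is_df_of \<mu> F \<Longrightarrow> df_measure F = \<mu>"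
  unfolding df_measure_def by (blast intro: is_df_of_unique)

definition marginal1 :: "(real \<times> real \<Rightarrow> real) \<Rightarrow> real \<Rightarrow> real" where
  "marginal1 F = cdf (distr (df_measure F) borel fst)"

definition marginal2 :: "(real \<times> real \<Rightarrow> real) \<Rightarrow> real \<Rightarrow> real" where
  "marginal2 F = cdf (distr (df_measure F) borel snd)"

definition Q_fun :: "(real \<times> real \<Rightarrow> real) \<Rightarrow> real \<times> real \<Rightarrow> real" where
  "Q_fun F x = marginal1 F (fst x) * marginal2 F (snd x) / F x"

definition T_fun :: "(real \<times> real \<Rightarrow> real) \<Rightarrow> real \<times> real \<Rightarrow> real" where
  "T_fun F x = marginal1 F (fst x) * marginal2 F (snd x) / F x
             - marginal1 F (fst x) - marginal2 F (snd x) + 1"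

text \<open>\<open>bifree_max_conv F G H\<close> says that \<open>H\<close> is the bi-free max-convolution of \<open>F\<close> and \<open>G\<close>.
  The conditions determine \<open>H\<close>. Where the equation for \<open>Q_fun H x\<close> applies, its right-hand side is
  positive (as \<open>F \<le> F\<^sub>1\<close> and \<open>F \<le> F\<^sub>2\<close>), so that it forces \<open>H x \<noteq> 0\<close> in spite of \<open>a / 0 = 0\<close>.\<close>

definition bifree_max_conv ::
  "(real \<times> real \<Rightarrow> real) \<Rightarrow> (real \<times> real \<Rightarrow> real) \<Rightarrow> (real \<times> real \<Rightarrow> real) \<Rightarrow> bool" where
  "bifree_max_conv F G H \<longleftrightarrow> bivariate_df F \<and> bivariate_df G \<and> bivariate_df H \<and>
     (\<forall>t. marginal1 H t = max (marginal1 F t + marginal1 G t - 1) 0) \<and>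
     (\<forall>t. marginal2 H t = max (marginal2 F t + marginal2 G t - 1) 0) \<and>
     (\<forall>x. if 0 < F x \<and> 0 < G x \<and> 0 < marginal1 H (fst x) \<and> 0 < marginal2 H (snd x)
          then Q_fun H x = Q_fun F x + Q_fun G x - 1
          else H x = 0)"

text \<open>\<open>bifree_max_power G n H\<close> says that \<open>H\<close> is the \<open>n\<close>-fold convolution of \<open>G\<close> with itself,
  for \<open>n \<ge> 1\<close>; there is no \<open>0\<close>-fold convolution.\<close>

inductive bifree_max_power ::
  "(real \<times> real \<Rightarrow> real) \<Rightarrow> nat \<Rightarrow> (real \<times> real \<Rightarrow> real) \<Rightarrow> bool" for G where
  one: "bivariate_df G \<Longrightarrow> bifree_max_power G 1 G"
| Suc: "bifree_max_power G n K \<Longrightarrow> bifree_max_conv K G H \<Longrightarrow> bifree_max_power G (Suc n) H"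

definition bifree_max_inf_div :: "(real \<times> real \<Rightarrow> real) \<Rightarrow> bool" where
  "bifree_max_inf_div F \<longleftrightarrow> (\<forall>n\<ge>1. \<exists>G. bivariate_df G \<and> bifree_max_power G n F)"

definition generalized_rectangle :: "real \<times> real \<Rightarrow> (real \<times> real) set \<Rightarrow> bool" where
  "generalized_rectangle L S \<longleftrightarrow>
     S = {fst L<..} \<times> {snd L<..} \<or> S = {fst L<..} \<times> {snd L..} \<or>
     S = {fst L..} \<times> {snd L<..} \<or> S = {fst L..} \<times> {snd L..}"

definition quasi_monotone_on :: "(real \<times> real) set \<Rightarrow> (real \<times> real \<Rightarrow> real) \<Rightarrow> bool" where
  "quasi_monotone_on S K \<longleftrightarrow>
     (\<forall>x1 x2 y1 y2. x1 \<le> y1 \<and> x2 \<le> y2 \<and> {x1..y1} \<times> {x2..y2} \<subseteq> S \<longrightarrow>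
        0 \<le> K (y1, y2) - K (x1, y2) - K (y1, x2) + K (x1, x2))"

definition continuous_from_above_on ::
  "(real \<times> real) set \<Rightarrow> (real \<times> real \<Rightarrow> real) \<Rightarrow> bool" where
  "continuous_from_above_on S K \<longleftrightarrow>
     (\<forall>x\<in>S. (K \<longlongrightarrow> K x) (at x within {y \<in> S. x \<le> y}))"

definition T_representation ::
  "(real \<times> real \<Rightarrow> real) \<Rightarrow> (real \<times> real \<Rightarrow> real) \<Rightarrow> real \<Rightarrow> bool" where
  "T_representation F H lam \<longleftrightarrow> bivariate_df H \<and> 0 < lam \<and>
     (\<forall>x. 0 < F x \<longrightarrow> T_fun F x = lam * (1 - H x))"

text \<open>\<open>\<tau>\<close> may be infinite. The conditions on its marginals make
  \<open>({x1<..} \<times> {x2<..})\<close> of finite measure for \<open>x1 > fst L\<close> and \<open>x2 > snd L\<close>, so that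
  the real-valued \<open>measure\<close> is adequate in the last clause.\<close>

definition tau_representation ::
  "(real \<times> real \<Rightarrow> real) \<Rightarrow> real \<times> real \<Rightarrow> (real \<times> real) measure \<Rightarrow> bool" where
  "tau_representation F L \<tau> \<longleftrightarrow> sets \<tau> = sets borel \<and> emeasure \<tau> UNIV \<noteq> 0 \<and>
     (\<forall>t > fst L. emeasure (distr \<tau> borel fst) {t<..} = ennreal (1 - marginal1 F t)) \<and>
     (\<forall>t > snd L. emeasure (distr \<tau> borel snd) {t<..} = ennreal (1 - marginal2 F t)) \<and>
     (\<forall>x1 > fst L. \<forall>x2 > snd L.
        F (x1, x2) = marginal1 F x1 * marginal2 F x2 / (1 - measure \<tau> ({x1<..} \<times> {x2<..})))"

end

theory Submission imports Defs begin

text \<open>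
  Write \<open>Q\<close> and \<open>T\<close> for \<open>Q_fun F\<close> and \<open>T_fun F\<close>. The marginal conditions and the equation for \<open>Q_fun\<close>
  in the definition of the convolution say that \<open>1 - F\<^sub>1\<close>, \<open>1 - F\<^sub>2\<close> and \<open>1 - Q\<close> add up under
  convolution, as long as nothing is cut off. So these three functions, and with them
  \<open>T = (1 - F\<^sub>1) + (1 - F\<^sub>2) - (1 - Q)\<close>, are the linear coordinates of the problem. If they are the
  \<open>\<tau>\<close>-masses of \<open>{z. x1 < fst z}\<close>, of \<open>{z. x2 < snd z}\<close> and of the intersection of these half-planes,
  then \<open>T\<close> is the mass of their union, which is the complement of the lower quadrant at \<open>(x1, x2)\<close>.
  The theorem says that infinite divisibility amounts to the existence of such a measure \<open>\<tau>\<close>.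

  Infinite divisibility, each of the two sets of monotonicity conditions, and the representation
  by \<open>\<tau>\<close> all imply that \<open>- T\<close> is increasing and quasi-monotone on the open quadrant above \<open>L\<close>.
  For infinite divisibility the reason is that the \<open>n\<close>-th root \<open>G n\<close> of \<open>F\<close> is explicit in the
  coordinates above and satisfies \<open>n * (G n x - 1) \<longlonglongrightarrow> - T x\<close> (\<open>bifree_root_limit\<close>), while
  \<open>G n\<close> itself is increasing and quasi-monotone. For \<open>\<tau>\<close> it is \<open>tau_imp_T_monotone\<close>.

  Conversely, let \<open>- T\<close> be increasing and quasi-monotone there. As \<open>T\<close> tends to \<open>1 - F\<^sub>1\<close> when the
  second coordinate grows and to \<open>1 - F\<^sub>2\<close> when the first one does, quasi-monotonicity bounds it by
  \<open>(1 - F\<^sub>1) + (1 - F\<^sub>2) \<le> 2\<close>. Hence \<open>1 - T / 2\<close>, extended to the boundary of the quadrant by limits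
  from above and by \<open>0\<close> elsewhere, is a distribution function \<open>H\<close>, and \<open>T = lam * (1 - H)\<close> with
  \<open>lam = 2\<close> (\<open>T_representation_exists\<close>). This uses that a normalized, right-continuous,
  quasi-monotone function on the plane comes from a probability measure (\<open>bivariate_df_existence\<close>).

  Given \<open>H\<close> and \<open>lam\<close>, with \<open>\<nu>\<close> the distribution belonging to \<open>H\<close>, the measure \<open>\<tau> = lam \<nu>\<close> has the
  property described above, and the monotonicity conditions express monotonicity and additivity
  of \<open>\<tau>\<close>. For infinite divisibility one replaces \<open>\<tau>\<close> by \<open>c \<tau>\<close> with \<open>0 < c < 1\<close>. The corresponding
  function \<open>conv_power c\<close> is \<open>(1 - c a) (1 - c b) / (1 - c k)\<close> for the three masses \<open>a\<close>, \<open>b\<close>, \<open>k\<close>. It is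
  again a distribution function, which rests on the elementary inequality
  \<open>quotient_quasi_monotone\<close>, and for \<open>n \<ge> 2\<close> the function \<open>conv_power (1 / n)\<close> is an \<open>n\<close>-th root of \<open>F\<close>.

  The formula for \<open>F\<close> in terms of \<open>\<tau>\<close> fixes \<open>\<tau>\<close> on the upper quadrants inside the open quadrant
  above \<open>L\<close>, hence on all its Borel subsets (\<open>tau_unique\<close>). If \<open>\<tau>\<close> is finite, then
  \<open>T = lam * (1 - H)\<close> for its total mass \<open>lam\<close> and its normalized distribution function \<open>H\<close>.
  Finally, \<open>H L = 1\<close> would force \<open>F\<^sub>1\<close> and \<open>F\<^sub>2\<close> to jump from \<open>0\<close> to \<open>1\<close> at the coordinates of \<open>L\<close>,
  so that \<open>F\<close> would belong to the constant \<open>L\<close>.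
\<close>

section \<open>Existence of bivariate distribution functions\<close>

text \<open>Distribution functions of finite measures on the line. The total mass is left open because
  the sections \<open>K (\<cdot>, b)\<close> of a bivariate distribution function and their differences occur below.\<close>

definition sub_cdf :: "(real \<Rightarrow> real) \<Rightarrow> bool" where
  "sub_cdf f \<longleftrightarrow> mono f \<and> (\<forall>a. continuous (at_right a) f) \<and> (f \<longlongrightarrow> 0) at_bot \<and>
     (\<exists>m. (f \<longlongrightarrow> m) at_top)"

lemma sub_cdf_nonneg:
  assumes "sub_cdf f" shows "0 \<le> f x"
proof (rule tendsto_upperbound)
  show "(f \<longlongrightarrow> 0) at_bot" using assms by (simp add: sub_cdf_def)
  show "\<forall>\<^sub>F y in at_bot. f y \<le> f x"
    using assms by (auto simp: sub_cdf_def eventually_at_bot_linorder mono_def intro!: exI[of _ x])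
qed simp

lemma sub_cdf_interval_measure:
  assumes "sub_cdf f"
  shows "finite_borel_measure (interval_measure f)" "cdf (interval_measure f) = f"
    "emeasure (interval_measure f) {..x} = ennreal (f x)"
proof -
  obtain m where m: "(f \<longlongrightarrow> m) at_top" using assms by (auto simp: sub_cdf_def)
  have "0 \<le> m"
    by (rule tendsto_lowerbound[OF m]) (use sub_cdf_nonneg[OF assms] in auto)
  then show "finite_borel_measure (interval_measure f)"
    using m assms by (intro finite_borel_measure_interval_measure) (auto simp: sub_cdf_def mono_def)
  show "cdf (interval_measure f) = f"
    using assms by (intro cdf_interval_measure) (auto simp: sub_cdf_def mono_def)
  show "emeasure (interval_measure f) {..x} = ennreal (f x)"
    using assms by (intro emeasure_interval_measure_Iic) (auto simp: sub_cdf_def mono_def)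
qed

lemma sub_cdf_add:
  assumes "sub_cdf f" "sub_cdf g" shows "sub_cdf (\<lambda>x. f x + g x)"
proof -
  obtain m m' where "(f \<longlongrightarrow> m) at_top" "(g \<longlongrightarrow> m') at_top" using assms by (auto simp: sub_cdf_def)
  then have "((\<lambda>x. f x + g x) \<longlongrightarrow> m + m') at_top" by (rule tendsto_add)
  moreover have "((\<lambda>x. f x + g x) \<longlongrightarrow> 0 + 0) at_bot"
    using assms by (intro tendsto_add) (auto simp: sub_cdf_def)
  ultimately show ?thesis
    using assms by (auto simp: sub_cdf_def mono_def intro!: continuous_add add_mono)
qed

text \<open>Both sides are finite measures with the same distribution function. The right-hand side is
  turned into a measure first, so that uniqueness for distribution functions applies.\<close>

lemma interval_measure_add:
  assumes f: "sub_cdf f" and g: "sub_cdf g" and A: "A \<in> sets borel"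
  shows "emeasure (interval_measure (\<lambda>x. f x + g x)) A =
    emeasure (interval_measure f) A + emeasure (interval_measure g) A"
proof -
  let ?m = "\<lambda>A. emeasure (interval_measure f) A + emeasure (interval_measure g) A"
  interpret f: finite_borel_measure "interval_measure f" by (rule sub_cdf_interval_measure[OF f])
  interpret g: finite_borel_measure "interval_measure g" by (rule sub_cdf_interval_measure[OF g])
  define S where "S = measure_of UNIV (sets borel) ?m"
  have sets: "sets S = sets borel" "space S = UNIV"
    unfolding S_def using sets.space_closed[of "borel :: real measure"]
    by (auto simp: sets.sigma_sets_eq[of borel, simplified])
  have em: "emeasure S B = ?m B" if "B \<in> sets borel" for B
    unfolding S_def
  proof (rule emeasure_measure_of_sigma)
    show "sigma_algebra UNIV (sets (borel :: real measure))"
      using sets.sigma_algebra_axioms[of borel] by simp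
    show "positive (sets borel) ?m" by (simp add: positive_def)
    show "countably_additive (sets borel) ?m"
    proof (rule countably_additiveI)
      fix B :: "nat \<Rightarrow> real set"
      assume B: "range B \<subseteq> sets borel" "disjoint_family B"
      have "(\<Sum>i. ?m (B i)) = (\<Sum>i. emeasure (interval_measure f) (B i)) + (\<Sum>i. emeasure (interval_measure g) (B i))"
        by (intro suminf_add[symmetric]) auto
      also have "\<dots> = ?m (\<Union>i. B i)"
        using B by (simp add: suminf_emeasure)
      finally show "(\<Sum>i. ?m (B i)) = ?m (\<Union>i. B i)" .
    qed
  qed (use that in auto)
  have fin: "finite_borel_measure S"
  proof (intro finite_borel_measure.intro finite_measureI finite_borel_measure_axioms.intro)
    show "emeasure S (space S) \<noteq> \<infinity>"
      using f.emeasure_finite[of UNIV] g.emeasure_finite[of UNIV]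
      by (simp add: sets(2) em[of UNIV])
  qed (rule sets(1))
  have "interval_measure (\<lambda>x. f x + g x) = S"
  proof (rule cdf_unique')
    show "cdf (interval_measure (\<lambda>x. f x + g x)) = cdf S"
    proof
      fix x
      have "ennreal (cdf S x) = emeasure S {..x}"
        using fin by (simp add: cdf_def finite_borel_measure_def finite_measure.emeasure_eq_measure)
      also have "\<dots> = ennreal (f x + g x)"
        using sub_cdf_nonneg[OF f] sub_cdf_nonneg[OF g]
        by (simp add: em sub_cdf_interval_measure(3)[OF f] sub_cdf_interval_measure(3)[OF g])
      finally have "cdf S x = f x + g x"
        using sub_cdf_nonneg[OF f, of x] sub_cdf_nonneg[OF g, of x]
        by (subst (asm) ennreal_inj) (auto simp: cdf_def)
      then show "cdf (interval_measure (\<lambda>x. f x + g x)) x = cdf S x"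
        by (simp add: sub_cdf_interval_measure(2)[OF sub_cdf_add[OF f g]])
    qed
  qed (use fin sub_cdf_interval_measure(1)[OF sub_cdf_add[OF f g]] in auto)
  then show ?thesis using em[OF A] by simp
qed

text \<open>By uniqueness of densities, the density of \<open>N\<close> is the sum of those of the two
  nonnegative parts \<open>N1\<close> and \<open>N2\<close>.\<close>

lemma RN_deriv_AE_mono:
  assumes "finite_measure M"
    and sets: "sets N1 = sets M" "sets N2 = sets M" "sets N = sets M"
    and sum: "\<And>A. A \<in> sets M \<Longrightarrow> emeasure N A = emeasure N1 A + emeasure N2 A"
    and ac: "absolutely_continuous M N"
  shows "AE x in M. RN_deriv M N1 x \<le> RN_deriv M N x"
proof -
  interpret finite_measure M by fact
  have ac1: "absolutely_continuous M N1" and ac2: "absolutely_continuous M N2"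
  proof -
    have "A \<in> null_sets N1 \<and> A \<in> null_sets N2" if "A \<in> null_sets M" for A
    proof -
      have A: "A \<in> sets M" "emeasure N A = 0"
        using ac that by (auto simp: absolutely_continuous_def dest: null_setsD1)
      with sum[OF A(1)] show ?thesis by (simp add: null_sets_def sets(1,2))
    qed
    then show "absolutely_continuous M N1" "absolutely_continuous M N2"
      by (auto simp: absolutely_continuous_def)
  qed
  have d1: "density M (RN_deriv M N1) = N1" by (rule density_RN_deriv[OF ac1 sets(1)])
  have d2: "density M (RN_deriv M N2) = N2" by (rule density_RN_deriv[OF ac2 sets(2)])
  have "density M (\<lambda>x. RN_deriv M N1 x + RN_deriv M N2 x) = N"
  proof (rule measure_eqI)
    fix A assume "A \<in> sets (density M (\<lambda>x. RN_deriv M N1 x + RN_deriv M N2 x))"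
    then have A: "A \<in> sets M" by simp
    have "emeasure (density M (\<lambda>x. RN_deriv M N1 x + RN_deriv M N2 x)) A =
       emeasure (density M (RN_deriv M N1)) A + emeasure (density M (RN_deriv M N2)) A"
      using A by (simp add: emeasure_density distrib_right nn_integral_add)
    also have "\<dots> = emeasure N A" using A by (simp add: d1 d2 sum)
    finally show "emeasure (density M (\<lambda>x. RN_deriv M N1 x + RN_deriv M N2 x)) A = emeasure N A" .
  qed (simp add: sets)
  then have "AE x in M. RN_deriv M N1 x + RN_deriv M N2 x = RN_deriv M N x"
    by (intro RN_deriv_unique) auto
  then show ?thesis
    by eventually_elim (metis le_iff_add)
qed

text \<open>The points \<open>up m x\<close> decrease to \<open>x\<close> and lie strictly above \<open>x\<close> in both coordinates. Limits
  from above are taken along this sequence; for monotone functions nothing is lost by that.\<close>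

definition up :: "nat \<Rightarrow> real \<times> real \<Rightarrow> real \<times> real" where
  "up m x = (fst x + inverse (real (Suc m)), snd x + inverse (real (Suc m)))"

lemma continuous_at_right_mono_seq:
  fixes f :: "real \<Rightarrow> real"
  assumes "mono f" "(\<lambda>m. f (a + inverse (real (Suc m)))) \<longlonglongrightarrow> f a"
  shows "continuous (at_right a) f"
proof -
  have "\<exists>b>a. \<forall>y. a < y \<and> y < b \<longrightarrow> \<bar>f y - f a\<bar> < e" if e: "e > 0" for e
  proof -
    obtain m where "\<bar>f (a + inverse (real (Suc m))) - f a\<bar> < e"
      using LIMSEQ_D[OF assms(2) e] by fastforce
    moreover have "f a \<le> f y \<and> f y \<le> f (a + inverse (real (Suc m)))"
      if "a < y \<and> y < a + inverse (real (Suc m))" for y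
      using that by (auto intro!: monoD[OF assms(1)])
    ultimately show ?thesis
      by (intro exI[of _ "a + inverse (real (Suc m))"]) (smt (verit) e inverse_positive_iff_positive of_nat_0_less_iff zero_less_Suc)
  qed
  then show ?thesis
    unfolding continuous_within
    unfolding tendsto_iff dist_real_def eventually_at_right_field by blast
qed

text \<open>The measure is built by conditional quantile sampling. The first coordinate \<open>x\<close> is drawn
  from the measure \<open>M\<close> with distribution function \<open>A\<close>, the first margin. The density \<open>\<phi> b\<close> of the
  measure belonging to \<open>K (\<cdot>, b)\<close> with respect to \<open>M\<close> plays the role of the
  conditional probability, given \<open>x\<close>, that the second coordinate is at most \<open>b\<close>. For a uniform \<open>u\<close>
  the second coordinate is the quantile \<open>Y\<close>, the infimum of the \<open>q\<close> with \<open>u \<le> \<phi> q x\<close>. Only rational \<open>q\<close> are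
  used, so that the almost sure monotonicity of \<open>\<phi>\<close> involves countably many null sets.\<close>

lemma quantile_sampling:
  fixes K :: "real \<times> real \<Rightarrow> real"
  assumes sub: "\<And>b. sub_cdf (\<lambda>a. K (a, b))"
    and inc: "\<And>b c. b \<le> c \<Longrightarrow> sub_cdf (\<lambda>a. K (a, c) - K (a, b))"
    and A: "sub_cdf A" "(A \<longlongrightarrow> 1) at_top"
    and Ainc: "\<And>b. sub_cdf (\<lambda>a. A a - K (a, b))"
    and right2: "\<And>a b. continuous (at_right b) (\<lambda>s. K (a, s))"
    and bot2: "\<And>a. ((\<lambda>b. K (a, b)) \<longlongrightarrow> 0) at_bot"
    and top: "(\<lambda>n. K (real n, real n)) \<longlonglongrightarrow> 1"
  shows "bivariate_df K"
proof -
  define M where "M = interval_measure A"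
  interpret M: finite_borel_measure M unfolding M_def by (rule sub_cdf_interval_measure[OF A(1)])
  define k where "k b = interval_measure (\<lambda>a. K (a, b))" for b
  define \<phi> where "\<phi> b = RN_deriv M (k b)" for b
  have sM[simp]: "sets M = sets borel" "space M = UNIV" by (simp_all add: M_def)
  interpret M: prob_space M
  proof
    have "emeasure M UNIV = 1" unfolding M_def
      using A sub_cdf_nonneg[OF A(1)]
      by (subst interval_measure_UNIV[where m=1]) (auto simp: sub_cdf_def mono_def)
    then show "emeasure M (space M) = 1" by simp
  qed
  have sk[simp]: "sets (k b) = sets borel" for b by (simp add: k_def)
  have ksum: "emeasure (k c) B = emeasure (k b) B + emeasure (interval_measure (\<lambda>a. K (a, c) - K (a, b))) B"
    if "b \<le> c" "B \<in> sets borel" for b c B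
    using interval_measure_add[OF sub[of b] inc[OF that(1)] that(2)] by (simp add: k_def)
  have Msum: "emeasure M B = emeasure (k b) B + emeasure (interval_measure (\<lambda>a. A a - K (a, b))) B"
    if "B \<in> sets borel" for b B
    using interval_measure_add[OF sub[of b] Ainc[of b] that] by (simp add: k_def M_def)
  have kac: "absolutely_continuous M (k b)" for b
    unfolding absolutely_continuous_def
  proof
    fix B assume "B \<in> null_sets M"
    then have B: "B \<in> sets borel" "emeasure M B = 0" by (auto simp: null_sets_def)
    with Msum[OF B(1), of b] show "B \<in> null_sets (k b)" by (simp add: null_sets_def)
  qed
  have dens: "density M (\<phi> b) = k b" for b
    unfolding \<phi>_def by (intro M.density_RN_deriv kac) simp
  have \<phi>_mono: "AE x in M. \<phi> b x \<le> \<phi> c x" if "b \<le> c" for b c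
    unfolding \<phi>_def
    by (rule RN_deriv_AE_mono[where ?N2.0="interval_measure (\<lambda>a. K (a, c) - K (a, b))"])
       (use that in \<open>auto intro: M.finite_measure_axioms kac ksum\<close>)
  have \<phi>_le1: "AE x in M. \<phi> b x \<le> 1" for b
  proof -
    have "AE x in M. RN_deriv M (k b) x \<le> RN_deriv M M x"
      by (rule RN_deriv_AE_mono[where ?N2.0="interval_measure (\<lambda>a. A a - K (a, b))"])
         (auto intro: M.finite_measure_axioms Msum simp: absolutely_continuous_def)
    moreover have "AE x in M. 1 = RN_deriv M M x"
      by (intro M.RN_deriv_unique) (auto simp: density_1)
    ultimately show ?thesis by eventually_elim (simp add: \<phi>_def)
  qed
  have [measurable]: "\<phi> b \<in> borel_measurable borel" for b
    using borel_measurable_RN_deriv[of M "k b"] unfolding \<phi>_def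
    by (subst measurable_cong_sets[of _ M]) auto
  define U where "U = uniform_measure lborel {0<..1::real}"
  interpret U: prob_space U
    unfolding U_def by (rule prob_space_uniform_measure) auto
  have sU[simp, measurable_cong]: "sets U = sets borel" "space U = UNIV" by (simp_all add: U_def)
  note sM[measurable_cong]
  define N where "N = M \<Otimes>\<^sub>M U"
  interpret MU: pair_prob_space M U ..
  interpret N: prob_space N unfolding N_def by (rule MU.prob_space_axioms)
  have sN[simp, measurable_cong]: "sets N = sets (borel \<Otimes>\<^sub>M borel)" "space N = UNIV"
    unfolding N_def by (auto simp: space_pair_measure intro!: sets_pair_measure_cong)
  \<comment> \<open>The infimum may be infinite on a null set, hence the type \<open>ereal\<close>.\<close>
  define Y :: "real \<times> real \<Rightarrow> ereal" where
    "Y z = (INF q\<in>\<rat>. if ennreal (snd z) \<le> \<phi> q (fst z) then ereal q else \<infinity>)" for z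
  have [measurable]: "Y \<in> borel_measurable (borel \<Otimes>\<^sub>M borel)"
    unfolding Y_def by (intro borel_measurable_INF countable_rat) measurable
  have Y_le: "Y z \<le> ereal q" if "q \<in> \<rat>" "ennreal (snd z) \<le> \<phi> q (fst z)" for z q
    unfolding Y_def by (rule INF_lower2[OF that(1)]) (simp add: that(2))
  \<comment> \<open>The region below the graph of \<open>\<phi> b\<close> has the mass that the event \<open>Y \<le> b\<close> should have.\<close>
  have below: "measure N {z. fst z \<le> a \<and> ennreal (snd z) \<le> \<phi> b (fst z)} = K (a, b)" for a b
  proof -
    have "emeasure N {z. fst z \<le> a \<and> ennreal (snd z) \<le> \<phi> b (fst z)} =
       (\<integral>\<^sup>+x. emeasure U (Pair x -` {z. fst z \<le> a \<and> ennreal (snd z) \<le> \<phi> b (fst z)}) \<partial>M)"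
      unfolding N_def
    proof (rule U.emeasure_pair_measure_alt)
      have "{z \<in> space N. fst z \<le> a \<and> ennreal (snd z) \<le> \<phi> b (fst z)} \<in> sets N"
        by measurable
      then show "{z. fst z \<le> a \<and> ennreal (snd z) \<le> \<phi> b (fst z)} \<in> sets (M \<Otimes>\<^sub>M U)"
        by (simp add: N_def[symmetric])
    qed
    also have "\<dots> = (\<integral>\<^sup>+x. \<phi> b x * indicator {..a} x \<partial>M)"
    proof (rule nn_integral_cong_AE)
      show "AE x in M. emeasure U (Pair x -` {z. fst z \<le> a \<and> ennreal (snd z) \<le> \<phi> b (fst z)}) =
          \<phi> b x * indicator {..a} x"
        using \<phi>_le1[of b]
      proof eventually_elim
        case (elim x)
        then obtain r where r: "0 \<le> r" "r \<le> 1" "\<phi> b x = ennreal r"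
          by (cases "\<phi> b x") (auto simp: top_unique simp flip: ennreal_1)
        show ?case
        proof (cases "x \<le> a")
          case True
          have "{0<..1} \<inter> {u. ennreal u \<le> ennreal r} = {0<..r}"
            using r by (auto simp: ennreal_le_iff)
          then show ?thesis using r True
            by (simp add: U_def vimage_def divide_ennreal_def)
        qed (simp add: vimage_def)
      qed
    qed
    also have "\<dots> = emeasure (k b) {..a}"
      unfolding dens[of b, symmetric]
      by (rule emeasure_density[symmetric]) (auto simp: \<phi>_def)
    also have "\<dots> = ennreal (K (a, b))" unfolding k_def by (rule sub_cdf_interval_measure(3)[OF sub])
    finally show ?thesis using sub_cdf_nonneg[OF sub] by (simp add: measure_def)
  qed
  have Kmono2: "K (a, b) \<le> K (a, c)" if "b \<le> c" for a b c
    using sub_cdf_nonneg[OF inc[OF that], of a] by simp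
  define E where "E a b = {z :: real \<times> real. fst z \<le> a \<and> Y z \<le> ereal b}" for a b
  have [measurable]: "E a b \<in> sets (borel \<Otimes>\<^sub>M borel)" for a b
  proof -
    have "{z \<in> space N. fst z \<le> a \<and> Y z \<le> ereal b} \<in> sets N" by measurable
    then show ?thesis by (simp add: E_def)
  qed
  have mono_N: "AE z in N. \<forall>q\<in>\<rat>. \<forall>r\<in>\<rat>. q \<le> r \<longrightarrow> \<phi> q (fst z) \<le> \<phi> r (fst z)"
  proof -
    have "AE x in M. \<forall>q\<in>\<rat>. \<forall>r\<in>\<rat>. q \<le> r \<longrightarrow> \<phi> q x \<le> \<phi> r x"
      using \<phi>_mono by (simp add: AE_ball_countable countable_rat)
    then have "AE x in distr N M fst. \<forall>q\<in>\<rat>. \<forall>r\<in>\<rat>. q \<le> r \<longrightarrow> \<phi> q x \<le> \<phi> r x" unfolding N_def U.distr_pair_fst .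
    then show ?thesis by (rule AE_distrD[rotated]) (simp add: N_def)
  qed
  \<comment> \<open>For rational \<open>q\<close> the event \<open>E a q\<close> contains the region below \<open>\<phi> q\<close>; for rational \<open>r > b\<close> the event
    \<open>E a b\<close> lies almost surely in the region below \<open>\<phi> r\<close>. By right continuity this determines its mass.\<close>
  have lower: "K (a, q) \<le> measure N (E a q)" if "q \<in> \<rat>" for a q
    unfolding below[symmetric]
  proof (rule N.finite_measure_mono)
    show "{z. fst z \<le> a \<and> ennreal (snd z) \<le> \<phi> q (fst z)} \<subseteq> E a q"
      unfolding E_def using Y_le[OF that] by auto
  qed simp
  have upper: "measure N (E a b) \<le> K (a, r)" if "r \<in> \<rat>" "b < r" for a b r
    unfolding below[symmetric]
  proof (rule N.finite_measure_mono_AE)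
    show "AE z in N. z \<in> E a b \<longrightarrow> z \<in> {z. fst z \<le> a \<and> ennreal (snd z) \<le> \<phi> r (fst z)}"
      using mono_N
    proof eventually_elim
      case (elim z)
      show ?case
      proof
        assume z: "z \<in> E a b"
        then have "Y z < ereal r" using that(2) by (auto simp: E_def intro: le_less_trans)
        then obtain q where q: "q \<in> \<rat>" "(if ennreal (snd z) \<le> \<phi> q (fst z) then ereal q else \<infinity>) < ereal r"
          unfolding Y_def INF_less_iff by auto
        then have "ennreal (snd z) \<le> \<phi> q (fst z)" "q \<le> r" by (auto split: if_splits)
        with elim q(1) that(1) z show "z \<in> {z. fst z \<le> a \<and> ennreal (snd z) \<le> \<phi> r (fst z)}"
          by (auto simp: E_def intro: order_trans)
      qed
    qed
    have "{z \<in> space N. fst z \<le> a \<and> ennreal (snd z) \<le> \<phi> r (fst z)} \<in> sets N" by measurable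
    then show "{z. fst z \<le> a \<and> ennreal (snd z) \<le> \<phi> r (fst z)} \<in> N.events" by simp
  qed
  have P_E: "measure N (E a b) = K (a, b)" for a b
  proof -
    have "\<exists>r\<in>\<rat>. b < r \<and> r < b + inverse (real (Suc m))" for m
      by (rule Rats_dense_in_real) simp
    then obtain r where r: "\<And>m. r m \<in> \<rat>" "\<And>m. b < r m" "\<And>m. r m < b + inverse (real (Suc m))"
      by metis
    have lim: "(\<lambda>m. b + inverse (real (Suc m))) \<longlonglongrightarrow> b"
      using tendsto_add[OF tendsto_const LIMSEQ_inverse_real_of_nat, of b] by simp
    have "r \<longlonglongrightarrow> b"
      by (rule tendsto_sandwich[OF _ _ tendsto_const lim])
         (use r in \<open>auto intro!: always_eventually less_imp_le\<close>)
    then have "filterlim r (at_right b) sequentially"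
      using r(2) by (auto simp: filterlim_at intro: always_eventually)
    then have "(\<lambda>m. K (a, r m)) \<longlonglongrightarrow> K (a, b)"
      using right2[where a=a and b=b] by (auto simp: continuous_within intro: filterlim_compose)
    then have 1: "measure N (E a b) \<le> K (a, b)"
      by (rule LIMSEQ_le_const) (use upper[OF r(1) r(2)] in auto)
    have "(\<lambda>m. measure N (E a (b + inverse (real (Suc m))))) \<longlonglongrightarrow>
        measure N (\<Inter>m. E a (b + inverse (real (Suc m))))"
    proof (rule N.finite_Lim_measure_decseq)
      show "decseq (\<lambda>m. E a (b + inverse (real (Suc m))))"
      proof (rule decseq_SucI)
        fix m
        have "inverse (real (Suc (Suc m))) \<le> inverse (real (Suc m))" by (rule le_imp_inverse_le) auto
        then show "E a (b + inverse (real (Suc (Suc m)))) \<subseteq> E a (b + inverse (real (Suc m)))"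
          unfolding E_def by (auto elim!: order_trans)
      qed
    qed auto
    also have "(\<Inter>m. E a (b + inverse (real (Suc m)))) = E a b"
    proof -
      have "y \<le> ereal b" if "\<forall>m. y \<le> ereal (b + inverse (real (Suc m)))" for y
        using that by (intro LIMSEQ_le_const[OF tendsto_ereal[OF lim]]) auto
      moreover have "ereal b \<le> ereal (b + inverse (real (Suc m)))" for m by simp
      ultimately show ?thesis unfolding E_def by (auto intro: order_trans)
    qed
    finally have "K (a, b) \<le> measure N (E a b)"
    proof (rule LIMSEQ_le_const, intro exI allI impI)
      fix m
      have "K (a, b) \<le> K (a, r m)" using r(2)[of m] by (intro Kmono2) simp
      also have "\<dots> \<le> measure N (E a (r m))" by (rule lower[OF r(1)])
      also have "\<dots> \<le> measure N (E a (b + inverse (real (Suc m))))"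
      proof (rule N.finite_measure_mono)
        show "E a (r m) \<subseteq> E a (b + inverse (real (Suc m)))"
          using r(3)[of m] by (auto simp: E_def elim!: order_trans)
      qed simp
      finally show "K (a, b) \<le> measure N (E a (b + inverse (real (Suc m))))" .
    qed
    with 1 show ?thesis by simp
  qed
  \<comment> \<open>\<open>Y < \<infinity>\<close> and \<open>Y > -\<infinity>\<close> almost surely, by the limits of \<open>K\<close> at \<open>\<infinity>\<close> and at \<open>-\<infinity>\<close>.\<close>
  have fin_top: "AE z in N. Y z \<noteq> \<infinity>"
  proof -
    have ev: "{z. Y z \<noteq> \<infinity>} \<in> N.events"
    proof -
      have "{z \<in> space N. Y z \<noteq> \<infinity>} \<in> sets N" by measurable
      then show ?thesis by simp
    qed
    have "1 \<le> measure N {z. Y z \<noteq> \<infinity>}"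
    proof (rule LIMSEQ_le_const2[OF top], intro exI allI impI)
      fix n
      show "K (real n, real n) \<le> measure N {z. Y z \<noteq> \<infinity>}"
        unfolding P_E[symmetric] using ev by (intro N.finite_measure_mono) (auto simp: E_def)
    qed
    then have "measure N {z. Y z \<noteq> \<infinity>} = 1" using N.prob_le_1 by (intro antisym) auto
    then show ?thesis using N.prob_eq_1[OF ev] by simp
  qed
  have fin_bot: "AE z in N. Y z \<noteq> -\<infinity>"
  proof -
    have "AE z in N. \<not> (fst z \<le> real n \<and> Y z = -\<infinity>)" for n
    proof -
      have ev: "{z. fst z \<le> real n \<and> Y z = -\<infinity>} \<in> N.events"
      proof -
        have "{z \<in> space N. fst z \<le> real n \<and> Y z = -\<infinity>} \<in> sets N" by measurable
        then show ?thesis by simp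
      qed
      have "measure N {z. fst z \<le> real n \<and> Y z = -\<infinity>} \<le> 0"
      proof (rule tendsto_lowerbound[OF bot2[of "real n"]])
        have "measure N {z. fst z \<le> real n \<and> Y z = -\<infinity>} \<le> K (real n, b)" for b
          unfolding P_E[symmetric]
        proof (rule N.finite_measure_mono)
          show "{z. fst z \<le> real n \<and> Y z = -\<infinity>} \<subseteq> E (real n) b" by (auto simp: E_def)
        qed simp
        then show "\<forall>\<^sub>F b in at_bot. measure N {z. fst z \<le> real n \<and> Y z = -\<infinity>} \<le> K (real n, b)"
          by simp
      qed simp
      then have "measure N {z. fst z \<le> real n \<and> Y z = -\<infinity>} = 0"
        by (simp add: measure_le_0_iff)
      then show ?thesis using N.prob_eq_0[OF ev] by simp
    qed
    then have "AE z in N. \<forall>n. \<not> (fst z \<le> real n \<and> Y z = -\<infinity>)" unfolding AE_all_countable ..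
    then show ?thesis
      by eventually_elim (metis real_arch_simple)
  qed
  define P where "P = distr N borel (\<lambda>z. (fst z, real_of_ereal (Y z)))"
  have meas: "(\<lambda>z. (fst z, real_of_ereal (Y z))) \<in> measurable N borel"
    unfolding borel_prod[symmetric] by measurable
  have "is_df_of P K"
    unfolding is_df_of_def
  proof (intro conjI allI)
    show "prob_space P" unfolding P_def by (rule N.prob_space_distr[OF meas])
    show "sets P = sets borel" by (simp add: P_def)
    fix x :: "real \<times> real"
    have Bs: "{..fst x} \<times> {..snd x} \<in> sets (borel :: (real \<times> real) measure)"
      unfolding borel_prod[symmetric] by (intro pair_measureI) auto
    have "measure P ({..fst x} \<times> {..snd x}) =
      measure N ((\<lambda>z. (fst z, real_of_ereal (Y z))) -` ({..fst x} \<times> {..snd x}) \<inter> space N)"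
      unfolding P_def by (rule measure_distr[OF meas Bs])
    also have "\<dots> = measure N (E (fst x) (snd x))"
    proof (rule N.finite_measure_eq_AE)
      show "AE z in N. (z \<in> (\<lambda>z. (fst z, real_of_ereal (Y z))) -` ({..fst x} \<times> {..snd x}) \<inter> space N)
          = (z \<in> E (fst x) (snd x))"
        using fin_top fin_bot
      proof eventually_elim
        case (elim z)
        then show ?case by (cases "Y z") (auto simp: E_def)
      qed
    qed (use measurable_sets[OF meas Bs] in auto)
    also have "\<dots> = K x" by (simp add: P_E)
    finally show "K x = measure P ({..fst x} \<times> {..snd x})" by simp
  qed
  then show ?thesis by (auto simp: bivariate_df_def)
qed

lemma sub_cdfI:
  assumes "mono f" "\<And>a. (\<lambda>m. f (a + inverse (real (Suc m)))) \<longlonglongrightarrow> f a"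
    "(f \<longlongrightarrow> 0) at_bot" "\<And>a. f a \<le> B"
  shows "sub_cdf f"
proof -
  have "incseq (\<lambda>n. f (real n))" using assms(1) by (auto simp: incseq_def mono_def)
  then obtain L where "(\<lambda>n. f (real n)) \<longlonglongrightarrow> L"
    using assms(4) by (metis incseq_convergent)
  then have "(f \<longlongrightarrow> L) at_top"
    using assms(1) by (intro tendsto_at_topI_sequentially_real)
  then show ?thesis
    using assms by (auto simp: sub_cdf_def intro: continuous_at_right_mono_seq)
qed

text \<open>The work left to do is to provide the first margin \<open>A a = lim K (a, n)\<close> for
  \<open>quantile_sampling\<close>. Its right continuity and its limit at \<open>-\<infinity>\<close> need a uniform control of this
  limit: by quasi-monotonicity, the mass above level \<open>n\<close> and to the left of \<open>n\<close> is at
  most \<open>1 - K (n, n)\<close>.\<close>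

lemma bivariate_df_existence:
  fixes K :: "real \<times> real \<Rightarrow> real"
  assumes quasi: "quasi_monotone_on UNIV K"
    and bot1: "\<And>b. ((\<lambda>a. K (a, b)) \<longlongrightarrow> 0) at_bot"
    and bot2: "\<And>a. ((\<lambda>b. K (a, b)) \<longlongrightarrow> 0) at_bot"
    and top: "(\<lambda>n. K (real n, real n)) \<longlonglongrightarrow> 1"
    and right: "\<And>x. (\<lambda>m. K (up m x)) \<longlonglongrightarrow> K x"
  shows "bivariate_df K"
proof -
  have q: "K (y1, x2) - K (x1, x2) \<le> K (y1, y2) - K (x1, y2)" if "x1 \<le> y1" "x2 \<le> y2" for x1 x2 y1 y2
    using quasi that unfolding quasi_monotone_on_def by (smt (verit) subset_UNIV)
  have mono1: "K (x1, y) \<le> K (y1, y)" if "x1 \<le> y1" for x1 y1 y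
  proof -
    have "0 - 0 \<le> K (y1, y) - K (x1, y)"
    proof (rule tendsto_upperbound[OF tendsto_diff[OF bot2 bot2]])
      show "\<forall>\<^sub>F b in at_bot. K (y1, b) - K (x1, b) \<le> K (y1, y) - K (x1, y)"
        using q[OF that] by (auto simp: eventually_at_bot_linorder)
    qed simp
    then show ?thesis by simp
  qed
  have mono2: "K (x, x2) \<le> K (x, y2)" if "x2 \<le> y2" for x x2 y2
  proof -
    have "0 - 0 \<le> K (x, y2) - K (x, x2)"
    proof (rule tendsto_upperbound[OF tendsto_diff[OF bot1 bot1]])
      show "\<forall>\<^sub>F a in at_bot. K (a, y2) - K (a, x2) \<le> K (x, y2) - K (x, x2)"
        using q[OF _ that] by (force simp: eventually_at_bot_linorder algebra_simps)
    qed simp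
    then show ?thesis by simp
  qed
  have le1: "K (a, b) \<le> 1" for a b
  proof (rule LIMSEQ_le_const[OF top])
    obtain N where N: "max a b \<le> real N" using real_arch_simple by blast
    show "\<exists>N. \<forall>n\<ge>N. K (a, b) \<le> K (real n, real n)"
    proof (intro exI allI impI)
      fix n assume "n \<ge> N"
      then have "a \<le> real n" "b \<le> real n" using N by (auto intro: order_trans[of _ "real N"])
      then show "K (a, b) \<le> K (real n, real n)" using mono1 mono2 by (meson order_trans)
    qed
  qed
  have r1: "(\<lambda>m. K (a + inverse (real (Suc m)), b)) \<longlonglongrightarrow> K (a, b)" for a b
    by (rule tendsto_sandwich[OF _ _ tendsto_const right[of "(a, b)"]])
       (auto simp: up_def intro!: always_eventually mono1 mono2)
  have r2: "(\<lambda>m. K (a, b + inverse (real (Suc m)))) \<longlonglongrightarrow> K (a, b)" for a b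
    by (rule tendsto_sandwich[OF _ _ tendsto_const right[of "(a, b)"]])
       (auto simp: up_def intro!: always_eventually mono1 mono2)
  define A where "A a = (SUP n. K (a, real n))" for a
  have bdd: "bdd_above (range (\<lambda>n. K (a, real n)))" for a using le1 by (intro bdd_aboveI[of _ 1]) auto
  have Alim: "(\<lambda>n. K (a, real n)) \<longlonglongrightarrow> A a" for a
    unfolding A_def by (rule LIMSEQ_incseq_SUP[OF bdd]) (auto simp: incseq_def intro: mono2)
  have A_ge: "K (a, b) \<le> A a" for a b
  proof -
    obtain n where "b \<le> real n" using real_arch_simple by blast
    then have "K (a, b) \<le> K (a, real n)" by (rule mono2)
    also have "\<dots> \<le> A a" unfolding A_def by (rule cSUP_upper[OF _ bdd]) simp
    finally show ?thesis .
  qed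
  have A_le: "A a \<le> K (a, real n) + (1 - K (real n, real n))" if "a \<le> real n" for a n
  proof (rule LIMSEQ_le_const2[OF Alim], intro exI allI impI)
    fix m assume "m \<ge> n"
    then have "K (real n, real n) - K (a, real n) \<le> K (real n, real m) - K (a, real m)"
      using that by (intro q) auto
    then show "K (a, real m) \<le> K (a, real n) + (1 - K (real n, real n))"
      using le1[of "real n" "real m"] by linarith
  qed
  have small: "\<exists>n. B \<le> real n \<and> 1 - K (real n, real n) < e" if "e > 0" for B e
  proof -
    have "\<forall>\<^sub>F n in sequentially. 1 - e < K (real n, real n)"
      using that by (intro order_tendstoD(1)[OF top]) simp
    moreover have "\<forall>\<^sub>F n in sequentially. B \<le> real n"
      using filterlim_real_sequentially by (simp add: filterlim_at_top)
    ultimately have "\<forall>\<^sub>F n in sequentially. B \<le> real n \<and> 1 - K (real n, real n) < e"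
      by eventually_elim auto
    then show ?thesis by (rule eventually_happens'[OF sequentially_bot])
  qed
  have sub: "sub_cdf (\<lambda>a. K (a, b))" for b
    by (rule sub_cdfI[OF _ r1 bot1 le1]) (auto simp: mono_def intro: mono1)
  have A1: "A a \<le> 1" for a
    by (rule LIMSEQ_le_const2[OF Alim]) (auto intro: le1)
  have A_mono: "mono A"
    by (intro monoI LIMSEQ_le[OF Alim Alim]) (auto intro: mono1)
  have A_bot: "(A \<longlongrightarrow> 0) at_bot"
  proof (rule order_tendstoI)
    fix e :: real assume "e < 0"
    then have "e < A a" for a using A_ge[of a 0] sub_cdf_nonneg[OF sub, of a 0] by linarith
    then show "\<forall>\<^sub>F a in at_bot. e < A a" by simp
  next
    fix e :: real assume "0 < e"
    then obtain n where n: "0 \<le> real n" "1 - K (real n, real n) < e / 2" using small[of "e/2" 0] by auto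
    have "\<forall>\<^sub>F a in at_bot. K (a, real n) < e / 2"
      using \<open>0 < e\<close> by (intro order_tendstoD(2)[OF bot1]) simp
    moreover have "\<forall>\<^sub>F a in at_bot. a \<le> real n" by (rule eventually_le_at_bot)
    ultimately show "\<forall>\<^sub>F a in at_bot. A a < e"
    proof eventually_elim
      case (elim a)
      then show ?case using A_le[of a n] n by linarith
    qed
  qed
  have A_right: "(\<lambda>m. A (a + inverse (real (Suc m)))) \<longlonglongrightarrow> A a" for a
  proof (rule order_tendstoI)
    fix e assume "e < A a"
    then have "e < A (a + inverse (real (Suc m)))" for m
      using monoD[OF A_mono, of a "a + inverse (real (Suc m))"] by auto
    then show "\<forall>\<^sub>F m in sequentially. e < A (a + inverse (real (Suc m)))" by simp
  next
    fix e assume e: "A a < e"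
    then obtain n where n: "a + 1 \<le> real n" "1 - K (real n, real n) < (e - A a) / 2"
      using small[of "(e - A a)/2" "a + 1"] by auto
    have "K (a, real n) < A a + (e - A a) / 2"
      using A_ge[of a "real n"] e by argo
    then have "\<forall>\<^sub>F m in sequentially. K (a + inverse (real (Suc m)), real n) < A a + (e - A a) / 2"
      by (rule order_tendstoD(2)[OF r1])
    then show "\<forall>\<^sub>F m in sequentially. A (a + inverse (real (Suc m))) < e"
    proof eventually_elim
      case (elim m)
      have "inverse (real (Suc m)) \<le> 1" by (simp add: field_simps)
      then have "A (a + inverse (real (Suc m))) \<le> K (a + inverse (real (Suc m)), real n) + (1 - K (real n, real n))"
        using n by (intro A_le) linarith
      then show ?case using elim n(2) by argo
    qed
  qed
  have A_sub: "sub_cdf A" by (rule sub_cdfI[OF A_mono A_right A_bot A1])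
  have A_top: "(A \<longlongrightarrow> 1) at_top"
  proof (rule tendsto_at_topI_sequentially_real[OF A_mono])
    show "(\<lambda>n. A (real n)) \<longlonglongrightarrow> 1"
      by (rule tendsto_sandwich[OF _ _ top tendsto_const])
         (auto intro!: always_eventually A_ge A1)
  qed
  show ?thesis
  proof (rule quantile_sampling[OF sub _ A_sub A_top _ _ bot2 top])
    show "sub_cdf (\<lambda>a. K (a, c) - K (a, b))" if "b \<le> c" for b c
    proof (rule sub_cdfI)
      show "mono (\<lambda>a. K (a, c) - K (a, b))"
        using q[OF _ that] by (force simp: mono_def)
      show "K (a, c) - K (a, b) \<le> 1" for a
        using le1[of a c] sub_cdf_nonneg[OF sub, of a b] by linarith
      show "((\<lambda>a. K (a, c) - K (a, b)) \<longlongrightarrow> 0) at_bot"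
        using tendsto_diff[OF bot1 bot1] by simp
    qed (intro tendsto_diff r1)
    show "sub_cdf (\<lambda>a. A a - K (a, b))" for b
    proof (rule sub_cdfI)
      show "mono (\<lambda>a. A a - K (a, b))"
      proof
        fix x y :: real assume xy: "x \<le> y"
        obtain N where N: "b \<le> real N" using real_arch_simple by blast
        show "A x - K (x, b) \<le> A y - K (y, b)"
        proof (rule LIMSEQ_le[OF tendsto_diff[OF Alim tendsto_const] tendsto_diff[OF Alim tendsto_const]],
              intro exI allI impI)
          fix n assume "N \<le> n"
          then have "b \<le> real n" using N by (auto intro: order_trans)
          from q[OF xy this] show "K (x, real n) - K (x, b) \<le> K (y, real n) - K (y, b)" by simp
        qed
      qed
      show "A a - K (a, b) \<le> 1" for a
        using A1[of a] sub_cdf_nonneg[OF sub, of a b] by linarith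
      show "((\<lambda>a. A a - K (a, b)) \<longlongrightarrow> 0) at_bot"
        using tendsto_diff[OF A_bot bot1] by simp
    qed (intro tendsto_diff r1 A_right)
    show "continuous (at_right b) (\<lambda>s. K (a, s))" for a b
      by (rule continuous_at_right_mono_seq[OF _ r2]) (auto simp: mono_def intro: mono2)
  qed
qed

section \<open>Distribution functions and their margins\<close>

lemma inverse_Suc_lim: "(\<lambda>m. a + inverse (real (Suc m))) \<longlonglongrightarrow> a"
  using tendsto_add[OF tendsto_const LIMSEQ_inverse_real_of_nat, of a] by simp

lemma le_of_le_inverse_Suc: "(\<And>m. y \<le> a + inverse (real (Suc m))) \<Longrightarrow> y \<le> (a :: real)"
  by (rule LIMSEQ_le_const[OF inverse_Suc_lim]) auto

lemma up_ge: "x \<le> up m x" "fst x < fst (up m x)" "snd x < snd (up m x)"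
  by (simp_all add: up_def less_eq_prod_def)

lemma up_antimono: "m \<le> n \<Longrightarrow> up n x \<le> up m x"
  by (auto simp: up_def less_eq_prod_def intro!: le_imp_inverse_le)

lemma up_mono: "x \<le> y \<Longrightarrow> up n x \<le> up n y"
  by (auto simp: up_def less_eq_prod_def)

locale planar_distribution = prob_space \<mu> for \<mu> :: "(real \<times> real) measure" +
  fixes F :: "real \<times> real \<Rightarrow> real"
  assumes df: "is_df_of \<mu> F"
begin

lemma sets_mu [simp, measurable_cong]: "sets \<mu> = sets borel"
  using df by (simp add: is_df_of_def)

lemma space_mu [simp]: "space \<mu> = UNIV"
  using sets_eq_imp_space_eq[OF sets_mu] by simp

lemma F_eq: "F (a, b) = measure \<mu> ({..a} \<times> {..b})"
  using df by (simp add: is_df_of_def)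

lemma df_measure: "df_measure F = \<mu>"
  using df by (rule df_measure_eq)

lemma bivariate: "bivariate_df F"
  using df by (auto simp: bivariate_df_def)

lemma borel_measurable_fst [simp]: "fst \<in> borel_measurable \<mu>" and borel_measurable_snd [simp]: "snd \<in> borel_measurable \<mu>"
  by (auto simp: measurable_cong_sets[OF sets_mu refl]
      intro!: borel_measurable_continuous_onI continuous_on_fst continuous_on_snd)

lemma marginal1_eq: "marginal1 F t = measure \<mu> ({..t} \<times> UNIV)"
proof -
  have "fst -` {..t} \<inter> space \<mu> = {..t} \<times> UNIV" by auto
  then show ?thesis
    unfolding marginal1_def cdf_def df_measure by (subst measure_distr) auto
qed

lemma marginal2_eq: "marginal2 F t = measure \<mu> (UNIV \<times> {..t})"
proof -
  have "snd -` {..t} \<inter> space \<mu> = UNIV \<times> {..t}" by auto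
  then show ?thesis
    unfolding marginal2_def cdf_def df_measure by (subst measure_distr) auto
qed

lemma measure_Un_times1:
  assumes "A \<in> sets borel" "A' \<in> sets borel" "B \<in> sets borel" "A \<inter> A' = {}" "C = A \<union> A'"
  shows "measure \<mu> (C \<times> B) = measure \<mu> (A \<times> B) + measure \<mu> (A' \<times> B)"
proof -
  have "C \<times> B = (A \<times> B) \<union> (A' \<times> B)" using assms by auto
  then show ?thesis using assms by (auto intro!: finite_measure_Union borel_Times)
qed

lemma measure_Un_times2:
  assumes "A \<in> sets borel" "A' \<in> sets borel" "B \<in> sets borel" "A \<inter> A' = {}" "C = A \<union> A'"
  shows "measure \<mu> (B \<times> C) = measure \<mu> (B \<times> A) + measure \<mu> (B \<times> A')"
proof -
  have "B \<times> C = (B \<times> A) \<union> (B \<times> A')" using assms by auto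
  then show ?thesis using assms by (auto intro!: finite_measure_Union borel_Times)
qed

lemma measure_UNIV: "measure \<mu> UNIV = 1"
  using prob_space by simp

lemma upper1: "measure \<mu> ({a<..} \<times> UNIV) = 1 - marginal1 F a"
  using measure_Un_times1[of "{..a}" "{a<..}" UNIV UNIV] measure_UNIV by (force simp: marginal1_eq)

lemma upper2: "measure \<mu> (UNIV \<times> {b<..}) = 1 - marginal2 F b"
  using measure_Un_times2[of "{..b}" "{b<..}" UNIV UNIV] measure_UNIV by (force simp: marginal2_eq)

lemma upper: "measure \<mu> ({a<..} \<times> {b<..}) = 1 - marginal1 F a - marginal2 F b + F (a, b)"
proof -
  have "measure \<mu> ({a<..} \<times> UNIV) = measure \<mu> ({a<..} \<times> {..b}) + measure \<mu> ({a<..} \<times> {b<..})"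
    by (rule measure_Un_times2) auto
  moreover have "measure \<mu> (UNIV \<times> {..b}) = measure \<mu> ({..a} \<times> {..b}) + measure \<mu> ({a<..} \<times> {..b})"
    by (rule measure_Un_times1) auto
  ultimately show ?thesis by (simp add: upper1 marginal2_eq F_eq)
qed

lemma quasi:
  assumes "x1 \<le> y1" "x2 \<le> y2"
  shows "0 \<le> F (y1, y2) - F (x1, y2) - F (y1, x2) + F (x1, x2)"
proof -
  have 1: "measure \<mu> ({..y1} \<times> {..y}) = measure \<mu> ({..x1} \<times> {..y}) + measure \<mu> ({x1<..y1} \<times> {..y})" for y
    using assms by (intro measure_Un_times1) auto
  have 2: "measure \<mu> ({x1<..y1} \<times> {..y2}) = measure \<mu> ({x1<..y1} \<times> {..x2}) + measure \<mu> ({x1<..y1} \<times> {x2<..y2})"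
    using assms by (intro measure_Un_times2) auto
  show ?thesis using 1[of x2] 1[of y2] 2 measure_nonneg[of \<mu> "{x1<..y1} \<times> {x2<..y2}"]
    by (simp add: F_eq)
qed

lemma mono: "x \<le> y \<Longrightarrow> F x \<le> F y"
  by (cases x; cases y) (auto simp: F_eq less_eq_prod_def intro!: finite_measure_mono borel_Times)

lemma nonneg: "0 \<le> F x"
  by (cases x) (simp add: F_eq)

lemma le_marginal1: "F (a, b) \<le> marginal1 F a"
  by (auto simp: F_eq marginal1_eq intro!: finite_measure_mono borel_Times)

lemma le_marginal2: "F (a, b) \<le> marginal2 F b"
  by (auto simp: F_eq marginal2_eq intro!: finite_measure_mono borel_Times)

lemma marginal_mono:
  "s \<le> t \<Longrightarrow> marginal1 F s \<le> marginal1 F t" "s \<le> t \<Longrightarrow> marginal2 F s \<le> marginal2 F t"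
  by (auto simp: marginal1_eq marginal2_eq intro!: finite_measure_mono borel_Times)

lemma marginal_le_1: "marginal1 F t \<le> 1" "marginal2 F t \<le> 1"
  by (auto simp: marginal1_eq marginal2_eq)

lemma marginal_nonneg: "0 \<le> marginal1 F t" "0 \<le> marginal2 F t"
  by (auto simp: marginal1_eq marginal2_eq)

lemma lim_marginal1: "(\<lambda>n. F (a, real n)) \<longlonglongrightarrow> marginal1 F a"
proof -
  have "(\<lambda>n. measure \<mu> ({..a} \<times> {..real n})) \<longlonglongrightarrow> measure \<mu> (\<Union>n. {..a} \<times> {..real n})"
    by (rule finite_Lim_measure_incseq) (auto simp: incseq_def intro!: borel_Times)
  also have "(\<Union>n. {..a} \<times> {..real n}) = {..a} \<times> UNIV" using real_arch_simple by auto
  finally show ?thesis by (simp add: F_eq marginal1_eq)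
qed

lemma lim_marginal2: "(\<lambda>n. F (real n, b)) \<longlonglongrightarrow> marginal2 F b"
proof -
  have "(\<lambda>n. measure \<mu> ({..real n} \<times> {..b})) \<longlonglongrightarrow> measure \<mu> (\<Union>n. {..real n} \<times> {..b})"
    by (rule finite_Lim_measure_incseq) (auto simp: incseq_def intro!: borel_Times)
  also have "(\<Union>n. {..real n} \<times> {..b}) = UNIV \<times> {..b}" using real_arch_simple by auto
  finally show ?thesis by (simp add: F_eq marginal2_eq)
qed

lemma marginals_lim_1: "(\<lambda>n. marginal1 F (real n)) \<longlonglongrightarrow> 1" "(\<lambda>n. marginal2 F (real n)) \<longlonglongrightarrow> 1"
proof -
  interpret D1: real_distribution "distr \<mu> borel fst" by (rule real_distribution_distr) simp
  interpret D2: real_distribution "distr \<mu> borel snd" by (rule real_distribution_distr) simp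
  show "(\<lambda>n. marginal1 F (real n)) \<longlonglongrightarrow> 1" "(\<lambda>n. marginal2 F (real n)) \<longlonglongrightarrow> 1"
    unfolding marginal1_def marginal2_def df_measure
    by (rule D1.cdf_lim_infty_prob D2.cdf_lim_infty_prob)+
qed

lemma right_continuous: "(\<lambda>m. F (up m x)) \<longlonglongrightarrow> F x"
proof -
  obtain a b where x: "x = (a, b)" by (cases x)
  let ?S = "\<lambda>m. {..a + inverse (real (Suc m))} \<times> {..b + inverse (real (Suc m))}"
  have "(\<lambda>m. measure \<mu> (?S m)) \<longlonglongrightarrow> measure \<mu> (\<Inter>m. ?S m)"
  proof (rule finite_Lim_measure_decseq)
    show "decseq ?S"
    proof (rule decseq_SucI)
      fix m
      have "inverse (real (Suc (Suc m))) \<le> inverse (real (Suc m))" by (rule le_imp_inverse_le) auto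
      then show "?S (Suc m) \<subseteq> ?S m" by (auto elim!: order_trans)
    qed
  qed (auto intro!: borel_Times)
  also have "(\<Inter>m. ?S m) = {..a} \<times> {..b}"
  proof -
    have "y \<le> c \<longleftrightarrow> (\<forall>m. y \<le> c + inverse (real (Suc m)))" for y c :: real
    proof
      assume "y \<le> c"
      then show "\<forall>m. y \<le> c + inverse (real (Suc m))" by (auto intro: order_trans[of _ c])
    qed (blast intro: le_of_le_inverse_Suc)
    then show ?thesis by auto
  qed
  finally show ?thesis by (simp add: F_eq up_def x)
qed

lemma marginal_right_continuous:
  "(\<lambda>m. marginal1 F (t + inverse (real (Suc m)))) \<longlonglongrightarrow> marginal1 F t"
  "(\<lambda>m. marginal2 F (t + inverse (real (Suc m)))) \<longlonglongrightarrow> marginal2 F t"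
proof -
  interpret D1: real_distribution "distr \<mu> borel fst" by (rule real_distribution_distr) simp
  interpret D2: real_distribution "distr \<mu> borel snd" by (rule real_distribution_distr) simp
  have "filterlim (\<lambda>m. t + inverse (real (Suc m))) (at_right t) sequentially"
    using inverse_Suc_lim[of t] by (auto simp: filterlim_at)
  note lim = filterlim_compose[OF _ this]
  show "(\<lambda>m. marginal1 F (t + inverse (real (Suc m)))) \<longlonglongrightarrow> marginal1 F t"
    using D1.cdf_is_right_cont[of t] unfolding marginal1_def df_measure continuous_within by (rule lim)
  show "(\<lambda>m. marginal2 F (t + inverse (real (Suc m)))) \<longlonglongrightarrow> marginal2 F t"
    using D2.cdf_is_right_cont[of t] unfolding marginal2_def df_measure continuous_within by (rule lim)
qed

end

lemma planar_distributionI: "is_df_of \<mu> F \<Longrightarrow> planar_distribution \<mu> F"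
  by (simp add: planar_distribution_def planar_distribution_axioms_def is_df_of_def)

lemma planar_distribution_df_measure: "bivariate_df F \<Longrightarrow> planar_distribution (df_measure F) F"
  using planar_distributionI df_measure_eq by (auto simp: bivariate_df_def)

section \<open>From monotonicity of \<open>- T_fun F\<close> to a representing distribution\<close>

text \<open>Extending by \<open>0\<close> below \<open>L\<close> keeps quasi-monotonicity: for a rectangle that sticks out of the
  closed quadrant above \<open>L\<close>, the alternating sum reduces to an increment along one side.\<close>

lemma bivariate_df_quadrant_existence:
  fixes K :: "real \<times> real \<Rightarrow> real"
  assumes out: "\<And>x. \<not> L \<le> x \<Longrightarrow> K x = 0"
    and nonneg: "\<And>x. L \<le> x \<Longrightarrow> 0 \<le> K x"
    and mono: "\<And>x y. L \<le> x \<Longrightarrow> x \<le> y \<Longrightarrow> K x \<le> K y"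
    and quasi: "\<And>x1 x2 y1 y2. L \<le> (x1, x2) \<Longrightarrow> x1 \<le> y1 \<Longrightarrow> x2 \<le> y2 \<Longrightarrow>
      0 \<le> K (y1, y2) - K (x1, y2) - K (y1, x2) + K (x1, x2)"
    and top: "(\<lambda>n. K (real n, real n)) \<longlonglongrightarrow> 1"
    and right: "\<And>x. L \<le> x \<Longrightarrow> (\<lambda>m. K (up m x)) \<longlonglongrightarrow> K x"
  shows "bivariate_df K"
proof (rule bivariate_df_existence)
  have K_mono: "K x \<le> K y" if "x \<le> y" for x y
  proof (cases "L \<le> y")
    case True
    then show ?thesis using mono[of x y] out[of x] nonneg[of y] that by (cases "L \<le> x") auto
  next
    case False
    then have "\<not> L \<le> x" using that order_trans by blast
    then show ?thesis using False by (simp add: out)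
  qed
  show "quasi_monotone_on UNIV K"
    unfolding quasi_monotone_on_def
  proof (intro allI impI)
    fix x1 x2 y1 y2 assume "x1 \<le> y1 \<and> x2 \<le> y2 \<and> {x1..y1} \<times> {x2..y2} \<subseteq> (UNIV :: (real \<times> real) set)"
    then have le: "x1 \<le> y1" "x2 \<le> y2" by auto
    consider "x1 < fst L" | "x2 < snd L" | "L \<le> (x1, x2)" by (force simp: less_eq_prod_def)
    then show "0 \<le> K (y1, y2) - K (x1, y2) - K (y1, x2) + K (x1, x2)"
    proof cases
      case 1
      then have "K (x1, y2) = 0" "K (x1, x2) = 0" by (auto intro!: out simp: less_eq_prod_def)
      then show ?thesis using K_mono[of "(y1, x2)" "(y1, y2)"] le by (simp add: less_eq_prod_def)
    next
      case 2
      then have "K (y1, x2) = 0" "K (x1, x2) = 0" by (auto intro!: out simp: less_eq_prod_def)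
      then show ?thesis using K_mono[of "(x1, y2)" "(y1, y2)"] le by (simp add: less_eq_prod_def)
    qed (use quasi le in auto)
  qed
  show "((\<lambda>a. K (a, b)) \<longlongrightarrow> 0) at_bot" for b
  proof (rule tendsto_eventually)
    show "\<forall>\<^sub>F a in at_bot. K (a, b) = 0"
      by (auto simp: eventually_at_bot_dense less_eq_prod_def intro!: out exI[of _ "fst L"])
  qed
  show "((\<lambda>b. K (a, b)) \<longlongrightarrow> 0) at_bot" for a
  proof (rule tendsto_eventually)
    show "\<forall>\<^sub>F b in at_bot. K (a, b) = 0"
      by (auto simp: eventually_at_bot_dense less_eq_prod_def intro!: out exI[of _ "snd L"])
  qed
  show "(\<lambda>n. K (real n, real n)) \<longlonglongrightarrow> 1" by (rule top)
  show "(\<lambda>m. K (up m x)) \<longlonglongrightarrow> K x" for x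
  proof (cases "L \<le> x")
    case False
    have "\<forall>\<^sub>F m in sequentially. \<not> L \<le> up m x"
    proof (cases "fst x < fst L")
      case True
      show ?thesis using order_tendstoD(2)[OF inverse_Suc_lim True]
        by eventually_elim (simp add: up_def less_eq_prod_def)
    next
      case F: False
      then have "snd x < snd L" using False by (auto simp: less_eq_prod_def)
      from order_tendstoD(2)[OF inverse_Suc_lim this] show ?thesis
        by eventually_elim (simp add: up_def less_eq_prod_def)
    qed
    then have "\<forall>\<^sub>F m in sequentially. K (up m x) = K x"
      by eventually_elim (use False in \<open>simp add: out\<close>)
    then show ?thesis by (rule tendsto_eventually)
  qed (rule right)
qed

text \<open>\<open>{F > 0}\<close> is the product of \<open>{F\<^sub>1 > 0}\<close> and \<open>{F\<^sub>2 > 0}\<close>. Its interior is the open quadrant \<open>Quad\<close>,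
  and every point of it is a limit of points of \<open>Quad\<close> from above.\<close>

locale rectangular_distribution = planar_distribution +
  fixes L :: "real \<times> real"
  assumes rect: "generalized_rectangle L {x. 0 < F x}"
begin

abbreviation F1 where "F1 \<equiv> marginal1 F"
abbreviation F2 where "F2 \<equiv> marginal2 F"
abbreviation Quad where "Quad \<equiv> {fst L<..} \<times> {snd L<..}"

lemma pos_Quad: "fst L < fst x \<Longrightarrow> snd L < snd x \<Longrightarrow> 0 < F x"
  using rect unfolding generalized_rectangle_def set_eq_iff by (cases x) force

lemma pos_ge: "0 < F x \<Longrightarrow> L \<le> x"
  using rect unfolding generalized_rectangle_def set_eq_iff
  by (cases x) (force simp: less_eq_prod_def)

lemma pos_product: "0 < F (a, b') \<Longrightarrow> 0 < F (a', b) \<Longrightarrow> 0 < F (a, b)"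
proof -
  obtain A B where "{x. 0 < F x} = A \<times> B"
    using rect unfolding generalized_rectangle_def by blast
  then have "0 < F (a, b) \<longleftrightarrow> a \<in> A \<and> b \<in> B" for a b by (auto simp: set_eq_iff)
  then show "0 < F (a, b') \<Longrightarrow> 0 < F (a', b) \<Longrightarrow> 0 < F (a, b)" by simp
qed

lemma pos_iff: "0 < F (a, b) \<longleftrightarrow> 0 < F1 a \<and> 0 < F2 b"
proof
  show "0 < F (a, b) \<Longrightarrow> 0 < F1 a \<and> 0 < F2 b"
    using le_marginal1[of a b] le_marginal2[of a b] by linarith
  assume *: "0 < F1 a \<and> 0 < F2 b"
  then have "\<forall>\<^sub>F n in sequentially. 0 < F (a, real n)" "\<forall>\<^sub>F n in sequentially. 0 < F (real n, b)"
    using order_tendstoD(1)[OF lim_marginal1] order_tendstoD(1)[OF lim_marginal2] by auto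
  then have "\<forall>\<^sub>F n in sequentially. 0 < F (a, b)"
    by eventually_elim (rule pos_product)
  then show "0 < F (a, b)" by simp
qed

lemma up_Quad: "L \<le> x \<Longrightarrow> up m x \<in> Quad"
  by (cases x) (auto simp: up_def less_eq_prod_def add_le_less_mono intro: le_less_trans)

lemma F1_pos: "fst L < a \<Longrightarrow> 0 < F1 a" and F2_pos: "snd L < b \<Longrightarrow> 0 < F2 b"
  using pos_Quad[of "(a, snd L + 1)"] pos_Quad[of "(fst L + 1, b)"] pos_iff by auto

lemma marginal1_zero: "F1 a = 0" if "a < fst L" for a
proof (rule ccontr)
  assume "F1 a \<noteq> 0"
  then have "0 < F1 a" using marginal_nonneg(1)[of a] by simp
  then have "0 < F (a, snd L + 1)" by (simp add: pos_iff F2_pos)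
  then show False using pos_ge that by (force simp: less_eq_prod_def)
qed

lemma marginal2_zero: "F2 b = 0" if "b < snd L" for b
proof (rule ccontr)
  assume "F2 b \<noteq> 0"
  then have "0 < F2 b" using marginal_nonneg(2)[of b] by simp
  then have "0 < F (fst L + 1, b)" by (simp add: pos_iff F1_pos)
  then show False using pos_ge that by (force simp: less_eq_prod_def)
qed

lemma eventually_real_gt: "\<forall>\<^sub>F n in sequentially. c < real n"
  using filterlim_real_sequentially by (simp add: filterlim_at_top_dense)

lemma T_fun_lim1: "0 < F1 a \<Longrightarrow> (\<lambda>n. T_fun F (a, real n)) \<longlonglongrightarrow> 1 - F1 a"
proof -
  assume a: "0 < F1 a"
  have "(\<lambda>n. F1 a * F2 (real n) / F (a, real n) - F1 a - F2 (real n) + 1) \<longlonglongrightarrow> F1 a * 1 / F1 a - F1 a - 1 + 1"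
    using a by (intro tendsto_intros lim_marginal1 marginals_lim_1) auto
  then show ?thesis using a by (simp add: T_fun_def)
qed

lemma T_fun_lim2: "0 < F2 b \<Longrightarrow> (\<lambda>n. T_fun F (real n, b)) \<longlonglongrightarrow> 1 - F2 b"
proof -
  assume a: "0 < F2 b"
  have "(\<lambda>n. F1 (real n) * F2 b / F (real n, b) - F1 (real n) - F2 b + 1) \<longlonglongrightarrow> 1 * F2 b / F2 b - 1 - F2 b + 1"
    using a by (intro tendsto_intros lim_marginal2 marginals_lim_1) auto
  then show ?thesis using a by (simp add: T_fun_def)
qed

lemma T_fun_right: "0 < F x \<Longrightarrow> (\<lambda>m. T_fun F (up m x)) \<longlonglongrightarrow> T_fun F x"
proof -
  assume a: "0 < F x"
  have "(\<lambda>m. F1 (fst (up m x)) * F2 (snd (up m x)) / F (up m x) - F1 (fst (up m x)) - F2 (snd (up m x)) + 1)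
     \<longlonglongrightarrow> F1 (fst x) * F2 (snd x) / F x - F1 (fst x) - F2 (snd x) + 1"
    using a by (intro tendsto_intros right_continuous)
      (auto simp: up_def intro: marginal_right_continuous simp del: of_nat_Suc)
  then show ?thesis by (simp add: T_fun_def)
qed

text \<open>The constant \<open>2\<close> is admissible because \<open>T \<le> (1 - F\<^sub>1) + (1 - F\<^sub>2)\<close>, so that \<open>1 - T / 2\<close> is
  nonnegative. Where \<open>F\<close> vanishes on the boundary of the quadrant, \<open>T\<close> has no meaningful value, and
  \<open>H\<close> is defined by the limit from above.\<close>

lemma T_representation_exists:
  assumes mono: "mono_on Quad (\<lambda>x. - T_fun F x)"
    and quasi: "quasi_monotone_on Quad (\<lambda>x. - T_fun F x)"
  shows "\<exists>H. T_representation F H 2"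
proof -
  let ?T = "T_fun F"
  have T_mono: "?T y \<le> ?T x" if "x \<in> Quad" "x \<le> y" for x y
  proof -
    have "y \<in> Quad" using that by (cases x, cases y) (auto simp: less_eq_prod_def)
    then show ?thesis using mono that by (auto simp: mono_on_def)
  qed
  have T_quasi: "?T (y1, y2) + ?T (x1, x2) \<le> ?T (x1, y2) + ?T (y1, x2)"
    if "(x1, x2) \<in> Quad" "x1 \<le> y1" "x2 \<le> y2" for x1 x2 y1 y2
  proof -
    have "{x1..y1} \<times> {x2..y2} \<subseteq> Quad" using that by auto
    then have "0 \<le> - ?T (y1, y2) - - ?T (x1, y2) - - ?T (y1, x2) + - ?T (x1, x2)"
      by (intro quasi[unfolded quasi_monotone_on_def, rule_format] conjI that(2,3))
    then show ?thesis by simp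
  qed
  have T_nonneg: "0 \<le> ?T x" if "x \<in> Quad" for x
  proof -
    obtain a b where x: "x = (a, b)" by (cases x)
    have "1 - F1 a \<le> ?T x"
    proof (rule tendsto_upperbound[OF T_fun_lim1])
      show "0 < F1 a" using that x by (auto intro: F1_pos)
      show "\<forall>\<^sub>F n in sequentially. ?T (a, real n) \<le> ?T x"
        using eventually_real_gt[of b]
        by eventually_elim (use that in \<open>auto intro!: T_mono simp: x less_eq_prod_def\<close>)
    qed simp
    then show ?thesis using marginal_le_1(1)[of a] by linarith
  qed
  have T_bound: "?T (a, b) \<le> (1 - F1 a) + (1 - F2 b)" if "(a, b) \<in> Quad" for a b
  proof (rule tendsto_lowerbound[OF tendsto_add[OF T_fun_lim1 T_fun_lim2]])
    show "0 < F1 a" "0 < F2 b" using that by (auto intro: F1_pos F2_pos)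
    show "\<forall>\<^sub>F n in sequentially. ?T (a, b) \<le> ?T (a, real n) + ?T (real n, b)"
      using eventually_real_gt[of a] eventually_real_gt[of b]
    proof eventually_elim
      case (elim n)
      have "0 \<le> ?T (real n, real n)" using that elim by (intro T_nonneg) auto
      then show ?case using T_quasi[OF that, of "real n" "real n"] elim by simp
    qed
  qed simp
  have T_le2: "?T x \<le> 2" if "x \<in> Quad" for x
    using T_bound[of "fst x" "snd x"] marginal_nonneg(1)[of "fst x"] marginal_nonneg(2)[of "snd x"] that
    by auto
  define H where "H x = (if L \<le> x then 1 - (SUP m. ?T (up m x)) / 2 else 0)" for x
  have H_lim: "(\<lambda>m. 1 - ?T (up m x) / 2) \<longlonglongrightarrow> H x" if "L \<le> x" for x
  proof -
    have "(\<lambda>m. ?T (up m x)) \<longlonglongrightarrow> (SUP m. ?T (up m x))"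
    proof (rule LIMSEQ_incseq_SUP)
      show "bdd_above (range (\<lambda>m. ?T (up m x)))"
        using T_le2[OF up_Quad[OF that]] by (intro bdd_aboveI[of _ 2]) auto
      show "incseq (\<lambda>m. ?T (up m x))"
        by (intro monoI T_mono up_Quad that up_antimono)
    qed
    then show ?thesis using that by (auto simp: H_def intro!: tendsto_intros)
  qed
  have T_H: "H x = 1 - ?T x / 2" if "0 < F x" for x
    using LIMSEQ_unique[OF H_lim[OF pos_ge[OF that]] tendsto_diff[OF tendsto_const tendsto_divide[OF T_fun_right[OF that] tendsto_const]]]
    by simp
  have H_out: "H x = 0" if "\<not> L \<le> x" for x using that by (simp add: H_def)
  have H_nonneg: "0 \<le> H x" if "L \<le> x" for x
  proof (rule LIMSEQ_le_const[OF H_lim[OF that]], intro exI allI impI)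
    fix n show "0 \<le> 1 - ?T (up n x) / 2" using T_le2[OF up_Quad[OF that, of n]] by simp
  qed
  have H_mono: "H x \<le> H y" if True: "L \<le> x" and that: "x \<le> y" for x y
  proof -
    have "L \<le> y" using True that by (rule order_trans)
    show ?thesis
    proof (rule LIMSEQ_le[OF H_lim[OF True] H_lim[OF \<open>L \<le> y\<close>]], intro exI allI impI)
      fix n show "1 - ?T (up n x) / 2 \<le> 1 - ?T (up n y) / 2"
        using T_mono[OF up_Quad[OF True] up_mono[OF that], of n] by simp
    qed
  qed
  have "bivariate_df H"
  proof (rule bivariate_df_quadrant_existence[where L=L])
    show "0 \<le> H (y1, y2) - H (x1, y2) - H (y1, x2) + H (x1, x2)"
      if x: "L \<le> (x1, x2)" and le: "x1 \<le> y1" "x2 \<le> y2" for x1 x2 y1 y2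
    proof -
      have L: "L \<le> (x1, y2)" "L \<le> (y1, x2)" "L \<le> (y1, y2)" using x le by (auto simp: less_eq_prod_def)
      show ?thesis
      proof (rule LIMSEQ_le_const[OF tendsto_add[OF tendsto_diff[OF tendsto_diff[OF
              H_lim[OF L(3)] H_lim[OF L(1)]] H_lim[OF L(2)]] H_lim[OF x]]], intro exI allI impI)
        fix n
        show "0 \<le> 1 - ?T (up n (y1, y2)) / 2 - (1 - ?T (up n (x1, y2)) / 2) -
            (1 - ?T (up n (y1, x2)) / 2) + (1 - ?T (up n (x1, x2)) / 2)"
          using T_quasi[of "fst (up n (x1, x2))" "snd (up n (x1, x2))" "fst (up n (y1, y2))" "snd (up n (y1, y2))"]
            up_Quad[OF x, of n] le by (simp add: up_def)
      qed
    qed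
    show "(\<lambda>n. H (real n, real n)) \<longlonglongrightarrow> 1"
    proof (rule tendsto_sandwich)
      have "(\<lambda>n. 1 - ((1 - F1 (real n)) + (1 - F2 (real n))) / 2) \<longlonglongrightarrow> 1 - ((1 - 1) + (1 - 1)) / 2"
        by (intro tendsto_intros marginals_lim_1) auto
      then show "(\<lambda>n. 1 - ((1 - F1 (real n)) + (1 - F2 (real n))) / 2) \<longlonglongrightarrow> 1" by simp
      show "\<forall>\<^sub>F n in sequentially. 1 - ((1 - F1 (real n)) + (1 - F2 (real n))) / 2 \<le> H (real n, real n)"
        using eventually_real_gt[of "fst L"] eventually_real_gt[of "snd L"]
      proof eventually_elim
        case (elim n)
        then show ?case using T_bound[of "real n" "real n"] T_H[of "(real n, real n)"]
            pos_Quad[of "(real n, real n)"] by simp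
      qed
      show "\<forall>\<^sub>F n in sequentially. H (real n, real n) \<le> 1"
        using eventually_real_gt[of "fst L"] eventually_real_gt[of "snd L"]
      proof eventually_elim
        case (elim n)
        then show ?case using T_nonneg[of "(real n, real n)"] T_H[of "(real n, real n)"]
            pos_Quad[of "(real n, real n)"] by simp
      qed
    qed simp
    show "(\<lambda>m. H (up m x)) \<longlonglongrightarrow> H x" if "L \<le> x" for x
    proof -
      have "H (up m x) = 1 - ?T (up m x) / 2" for m
        using up_Quad[OF that, of m] by (intro T_H pos_Quad) (auto simp: mem_Times_iff)
      then show ?thesis using H_lim[OF that] by simp
    qed
  qed (auto intro: H_out H_nonneg H_mono)
  then have "T_representation F H 2"
    unfolding T_representation_def using T_H by auto
  then show ?thesis by blast
qed

end

section \<open>From a representing distribution to infinite divisibility\<close>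

text \<open>\<open>A * D' \<le> A * (D + (A' - A)) \<le> A' * D\<close>, where the second step uses \<open>A \<le> D\<close>.\<close>

lemma quotient_mono:
  fixes A A' B D D' :: real
  assumes "0 < A" "A \<le> D" "A \<le> A'" "0 \<le> B" "D \<le> D'" "D' - D \<le> A' - A"
  shows "A * B / D \<le> A' * B / D'"
proof -
  have "A * D' \<le> A * (D + (A' - A))"
    using assms by (intro mult_left_mono) auto
  also have "\<dots> = A * D + A * (A' - A)" by (simp add: algebra_simps)
  also have "\<dots> \<le> A * D + D * (A' - A)"
    using assms by (intro add_left_mono mult_right_mono) auto
  also have "\<dots> = A' * D" by (simp add: algebra_simps)
  finally have "A / D \<le> A' / D'" using assms by (simp add: frac_le_eq divide_le_eq frac_less_eq field_simps)
  then have "A / D * B \<le> A' / D' * B" using assms by (intro mult_right_mono)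
  then show ?thesis by simp
qed

text \<open>With \<open>e = D - r - s\<close>, \<open>a = A / (D - r) \<le> 1\<close> and \<open>b = B / (D - s) \<le> 1\<close>, the
  alternating sum for \<open>p = 0\<close> equals \<open>(\<alpha> - a r) (\<beta> - b s) / D + a b r s / e\<close>, a sum of
  nonnegative terms. A positive \<open>p\<close> only increases the last quotient. In the application \<open>r\<close>, \<open>s\<close>
  and \<open>p\<close> are, up to a constant factor, the masses of the two strips and of the cell that a rectangle cuts out of an upper
  quadrant.\<close>

lemma quotient_quasi_monotone:
  fixes A B \<alpha> \<beta> D r s p :: real
  assumes pos: "0 \<le> A" "0 \<le> B" "0 \<le> r" "0 \<le> s" "0 \<le> p" "0 < D - r - s - p"
    and le: "r \<le> \<alpha>" "s \<le> \<beta>" "A \<le> D - r" "B \<le> D - s"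
  shows "0 \<le> (A + \<alpha>) * (B + \<beta>) / D - A * (B + \<beta>) / (D - r) - (A + \<alpha>) * B / (D - s)
    + A * B / (D - r - s - p)"
proof -
  define e a b where "e = D - r - s" and "a = A / (D - r)" and "b = B / (D - s)"
  have e: "0 < e" "0 < D" "0 < D - r" "0 < D - s" using pos by (auto simp: e_def)
  have ab: "0 \<le> a" "a \<le> 1" "0 \<le> b" "b \<le> 1" using pos le e by (auto simp: a_def b_def)
  define x y where "x = \<alpha> - a * r" and "y = \<beta> - b * s"
  have "a * r \<le> 1 * r" "b * s \<le> 1 * s" using ab pos by (intro mult_right_mono; simp)+
  then have xy: "0 \<le> x" "0 \<le> y" using le by (auto simp: x_def y_def)
  have "A = a * (D - r)" "B = b * (D - s)" using e by (auto simp: a_def b_def)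
  then have A: "A = a * D - a * r" and B: "B = b * D - b * s" by (simp_all add: right_diff_distrib)
  have "A * B = a * b * (e * D + r * s)"
    unfolding A B e_def by (simp add: algebra_simps)
  then have ABe: "A * B / e = a * b * D + a * b * r * s / e"
    using e by (simp add: field_simps)
  have "(A + \<alpha>) * (B + \<beta>) / D = (a * D + x) * (b * D + y) / D"
    by (simp only: A B x_def y_def) (simp add: algebra_simps)
  also have "\<dots> = a * b * D + a * y + b * x + x * y / D"
    using e by (simp add: field_simps)
  finally have 1: "(A + \<alpha>) * (B + \<beta>) / D = a * b * D + a * y + b * x + x * y / D" .
  have 2: "A * (B + \<beta>) / (D - r) = a * (b * D + y)" "(A + \<alpha>) * B / (D - s) = (a * D + x) * b"
  proof -
    have "A * (B + \<beta>) / (D - r) = a * (B + \<beta>)" "(A + \<alpha>) * B / (D - s) = (A + \<alpha>) * b"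
      by (simp_all add: a_def b_def)
    then show "A * (B + \<beta>) / (D - r) = a * (b * D + y)" "(A + \<alpha>) * B / (D - s) = (a * D + x) * b"
      by (simp_all add: A B x_def y_def algebra_simps)
  qed
  have "A * B / e \<le> A * B / (D - r - s - p)"
    using pos by (intro divide_left_mono) (auto simp: e_def)
  moreover have "0 \<le> x * y / D + a * b * r * s / e"
    using xy ab pos e by (intro add_nonneg_nonneg) auto
  ultimately show ?thesis
    unfolding 1 2 using ABe by (simp add: algebra_simps)
qed

text \<open>The situation \<open>T = lam * (1 - H)\<close>. All conditions are read off from the finite measure
  \<open>lam \<nu>\<close>, mainly through its mass on upper quadrants.\<close>

locale represented_distribution = rectangular_distribution \<mu> F L + H: planar_distribution \<nu> H
  for \<mu> F L \<nu> H +
  fixes lam :: real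
  assumes lam_pos: "0 < lam"
    and T_eq: "0 < F x \<Longrightarrow> T_fun F x = lam * (1 - H x)"
begin

abbreviation H1 where "H1 \<equiv> marginal1 H"
abbreviation H2 where "H2 \<equiv> marginal2 H"

definition upper_mass :: "real \<Rightarrow> real \<Rightarrow> real" where
  "upper_mass a b = lam * measure \<nu> ({a<..} \<times> {b<..})"

lemma upper_mass_eq: "upper_mass a b = lam * (1 - H1 a - H2 b + H (a, b))"
  by (simp add: upper_mass_def H.upper)

text \<open>Letting the second coordinate tend to infinity in \<open>T = lam * (1 - H)\<close> gives the equation to the
  right of \<open>fst L\<close>; right continuity adds the boundary point, even if \<open>F\<close> vanishes on the vertical line through it.\<close>

lemma marginal1_rep:
  assumes "fst L \<le> a" shows "1 - F1 a = lam * (1 - H1 a)"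
proof -
  have *: "1 - F1 a = lam * (1 - H1 a)" if "fst L < a" for a
  proof (rule LIMSEQ_unique[OF T_fun_lim1[OF F1_pos[OF that]]])
    have "\<forall>\<^sub>F n in sequentially. lam * (1 - H (a, real n)) = T_fun F (a, real n)"
      using eventually_real_gt[of "snd L"]
      by eventually_elim (use that in \<open>auto intro!: T_eq[symmetric] pos_Quad\<close>)
    moreover have "(\<lambda>n. lam * (1 - H (a, real n))) \<longlonglongrightarrow> lam * (1 - H1 a)"
      by (intro tendsto_intros H.lim_marginal1)
    ultimately show "(\<lambda>n. T_fun F (a, real n)) \<longlonglongrightarrow> lam * (1 - H1 a)"
      by (rule Lim_transform_eventually[rotated])
  qed
  show ?thesis
  proof (rule LIMSEQ_unique)
    show "(\<lambda>m. 1 - F1 (a + inverse (real (Suc m)))) \<longlonglongrightarrow> 1 - F1 a"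
      by (intro tendsto_intros marginal_right_continuous)
    have "1 - F1 (a + inverse (real (Suc m))) = lam * (1 - H1 (a + inverse (real (Suc m))))" for m
      by (intro * le_less_trans[OF assms]) simp
    moreover have "(\<lambda>m. lam * (1 - H1 (a + inverse (real (Suc m))))) \<longlonglongrightarrow> lam * (1 - H1 a)"
      by (intro tendsto_intros H.marginal_right_continuous)
    ultimately show "(\<lambda>m. 1 - F1 (a + inverse (real (Suc m)))) \<longlonglongrightarrow> lam * (1 - H1 a)" by presburger
  qed
qed

lemma marginal2_rep:
  assumes "snd L \<le> b" shows "1 - F2 b = lam * (1 - H2 b)"
proof -
  have *: "1 - F2 b = lam * (1 - H2 b)" if "snd L < b" for b
  proof (rule LIMSEQ_unique[OF T_fun_lim2[OF F2_pos[OF that]]])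
    have "\<forall>\<^sub>F n in sequentially. lam * (1 - H (real n, b)) = T_fun F (real n, b)"
      using eventually_real_gt[of "fst L"]
      by eventually_elim (use that in \<open>auto intro!: T_eq[symmetric] pos_Quad\<close>)
    moreover have "(\<lambda>n. lam * (1 - H (real n, b))) \<longlonglongrightarrow> lam * (1 - H2 b)"
      by (intro tendsto_intros H.lim_marginal2)
    ultimately show "(\<lambda>n. T_fun F (real n, b)) \<longlonglongrightarrow> lam * (1 - H2 b)"
      by (rule Lim_transform_eventually[rotated])
  qed
  show ?thesis
  proof (rule LIMSEQ_unique)
    show "(\<lambda>m. 1 - F2 (b + inverse (real (Suc m)))) \<longlonglongrightarrow> 1 - F2 b"
      by (intro tendsto_intros marginal_right_continuous)
    have "1 - F2 (b + inverse (real (Suc m))) = lam * (1 - H2 (b + inverse (real (Suc m))))" for m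
      by (intro * le_less_trans[OF assms]) simp
    moreover have "(\<lambda>m. lam * (1 - H2 (b + inverse (real (Suc m))))) \<longlonglongrightarrow> lam * (1 - H2 b)"
      by (intro tendsto_intros H.marginal_right_continuous)
    ultimately show "(\<lambda>m. 1 - F2 (b + inverse (real (Suc m)))) \<longlonglongrightarrow> lam * (1 - H2 b)" by presburger
  qed
qed

lemma Q_eq:
  assumes "0 < F (a, b)" shows "Q_fun F (a, b) = 1 - upper_mass a b"
proof -
  have "L \<le> (a, b)" by (rule pos_ge[OF assms])
  then have "1 - F1 a = lam * (1 - H1 a)" "1 - F2 b = lam * (1 - H2 b)"
    by (auto intro: marginal1_rep marginal2_rep simp: less_eq_prod_def)
  moreover have "Q_fun F (a, b) = lam * (1 - H (a, b)) - (1 - F1 a) - (1 - F2 b) + 1"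
    using T_eq[OF assms] by (simp add: T_fun_def Q_fun_def)
  ultimately show ?thesis by (simp add: upper_mass_eq algebra_simps)
qed

lemma upper_mass_nonneg: "0 \<le> upper_mass a b"
  using lam_pos by (simp add: upper_mass_def)

lemma upper_mass_antimono: "a \<le> a' \<Longrightarrow> b \<le> b' \<Longrightarrow> upper_mass a' b' \<le> upper_mass a b"
  unfolding upper_mass_def using lam_pos
  by (intro mult_left_mono H.finite_measure_mono) (auto intro!: borel_Times)

lemma upper_mass_quasi:
  "x1 \<le> y1 \<Longrightarrow> x2 \<le> y2 \<Longrightarrow> 0 \<le> upper_mass y1 y2 - upper_mass x1 y2 - upper_mass y1 x2 + upper_mass x1 x2"
proof -
  assume "x1 \<le> y1" "x2 \<le> y2"
  then have "0 \<le> lam * (H (y1, y2) - H (x1, y2) - H (y1, x2) + H (x1, x2))"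
    using H.quasi lam_pos by simp
  also have "\<dots> = upper_mass y1 y2 - upper_mass x1 y2 - upper_mass y1 x2 + upper_mass x1 x2" by (simp add: upper_mass_eq algebra_simps)
  finally show ?thesis .
qed

lemma upper_mass_increment1:
  assumes "fst L \<le> a" "a \<le> a'" shows "upper_mass a b - upper_mass a' b \<le> F1 a' - F1 a"
proof -
  have "lam * (H (a, b)) \<le> lam * H (a', b)"
    using lam_pos assms by (intro mult_left_mono H.mono) (auto simp: less_eq_prod_def)
  then show ?thesis
    using marginal1_rep[OF assms(1)] marginal1_rep[of a'] assms by (simp add: upper_mass_eq algebra_simps)
qed

lemma upper_mass_increment2:
  assumes "snd L \<le> b" "b \<le> b'" shows "upper_mass a b - upper_mass a b' \<le> F2 b' - F2 b"
proof -
  have "lam * (H (a, b)) \<le> lam * H (a, b')"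
    using lam_pos assms by (intro mult_left_mono H.mono) (auto simp: less_eq_prod_def)
  then show ?thesis
    using marginal2_rep[OF assms(1)] marginal2_rep[of b'] assms by (simp add: upper_mass_eq algebra_simps)
qed

lemma upper_mass_le_marginal1: "fst L \<le> a \<Longrightarrow> upper_mass a b \<le> 1 - F1 a"
  using H.le_marginal2[of a b] lam_pos by (simp add: marginal1_rep upper_mass_eq)

lemma upper_mass_le_marginal2: "snd L \<le> b \<Longrightarrow> upper_mass a b \<le> 1 - F2 b"
  using H.le_marginal1[of a b] lam_pos by (simp add: marginal2_rep upper_mass_eq)

lemma upper_mass_right: "(\<lambda>m. upper_mass (fst (up m x)) (snd (up m x))) \<longlonglongrightarrow> upper_mass (fst x) (snd x)"
  unfolding upper_mass_eq prod.collapse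
  by (intro tendsto_intros H.right_continuous)
     (auto simp: up_def intro: H.marginal_right_continuous simp del: of_nat_Suc)

text \<open>The candidate for the convolution power of \<open>F\<close> with exponent \<open>c\<close>: the measure \<open>lam \<nu>\<close> is
  multiplied by \<open>c\<close>. For \<open>c < 1\<close> the function is positive on the whole closed quadrant above \<open>L\<close>, also at
  boundary points where \<open>F\<close> vanishes.\<close>

definition conv_power :: "real \<Rightarrow> real \<times> real \<Rightarrow> real" where
  "conv_power c x = (if L \<le> x
     then (1 - c * (1 - F1 (fst x))) * (1 - c * (1 - F2 (snd x))) / (1 - c * upper_mass (fst x) (snd x)) else 0)"

context
  fixes c :: real
  assumes c: "0 < c" "c < 1"
begin

lemma conv_power_bounds:
  shows "fst L \<le> a \<Longrightarrow> 1 - c * (1 - F1 a) \<le> 1 - c * upper_mass a b"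
    "snd L \<le> b \<Longrightarrow> 1 - c * (1 - F2 b) \<le> 1 - c * upper_mass a b"
    "0 < 1 - c * (1 - F1 a)" "0 < 1 - c * (1 - F2 b)"
    "fst L \<le> a \<Longrightarrow> 0 < 1 - c * upper_mass a b"
proof -
  show 1: "1 - c * (1 - F1 a) \<le> 1 - c * upper_mass a b" if "fst L \<le> a" for a b
    using upper_mass_le_marginal1[OF that] c by simp
  show "1 - c * (1 - F2 b) \<le> 1 - c * upper_mass a b" if "snd L \<le> b"
    using upper_mass_le_marginal2[OF that] c by simp
  have "c * (1 - t) < 1" if "0 \<le> t" "t \<le> 1" for t
  proof -
    have "c * (1 - t) \<le> c * 1" using that c by (intro mult_left_mono) auto
    also have "\<dots> < 1" using c by simp
    finally show ?thesis .
  qed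
  then show 2: "0 < 1 - c * (1 - F1 a)" and "0 < 1 - c * (1 - F2 b)"  for a b
    using marginal_nonneg marginal_le_1 by auto
  show "0 < 1 - c * upper_mass a b" if "fst L \<le> a" using 1[OF that, of b] 2[of a] by linarith
qed

lemma conv_power_pos: "L \<le> x \<Longrightarrow> 0 < conv_power c x"
  using conv_power_bounds(3)[of "fst x"] conv_power_bounds(4)[of "snd x"]
    conv_power_bounds(5)[of "fst x" "snd x"]
  by (simp add: conv_power_def less_eq_prod_def)

text \<open>Monotonicity and quasi-monotonicity are the two quotient inequalities above. Their hypotheses
  hold because a strip of an upper quadrant has no more mass than the strip of the half-plane
  containing it.\<close>

lemma bivariate_df_conv_power: "bivariate_df (conv_power c)"
proof (rule bivariate_df_quadrant_existence[where L=L])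
  show "conv_power c x = 0" if "\<not> L \<le> x" for x using that by (simp add: conv_power_def)
  show "0 \<le> conv_power c x" if "L \<le> x" for x using conv_power_pos[OF that] by simp
  show "conv_power c x \<le> conv_power c y" if x: "L \<le> x" and xy: "x \<le> y" for x y
  proof -
    obtain x1 x2 y1 y2 where eq: "x = (x1, x2)" "y = (y1, y2)" by (cases x, cases y)
    have L: "fst L \<le> x1" "snd L \<le> x2" "fst L \<le> y1" "snd L \<le> y2" and le: "x1 \<le> y1" "x2 \<le> y2"
      using x xy by (auto simp: eq less_eq_prod_def)
    note bounds = conv_power_bounds
    have "(1 - c * (1 - F1 x1)) * (1 - c * (1 - F2 x2)) / (1 - c * upper_mass x1 x2) \<le>
      (1 - c * (1 - F1 y1)) * (1 - c * (1 - F2 x2)) / (1 - c * upper_mass y1 x2)"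
    proof (rule quotient_mono)
      have "c * (upper_mass x1 x2 - upper_mass y1 x2) \<le> c * (F1 y1 - F1 x1)"
        using upper_mass_increment1[OF L(1) le(1)] c by (intro mult_left_mono) auto
      then show "1 - c * upper_mass y1 x2 - (1 - c * upper_mass x1 x2) \<le> 1 - c * (1 - F1 y1) - (1 - c * (1 - F1 x1))"
        by (simp add: algebra_simps)
    qed (use bounds L le c marginal_mono upper_mass_antimono in \<open>auto intro: less_imp_le\<close>)
    also have "\<dots> = (1 - c * (1 - F2 x2)) * (1 - c * (1 - F1 y1)) / (1 - c * upper_mass y1 x2)"
      by (simp add: mult.commute)
    also have "\<dots> \<le> (1 - c * (1 - F2 y2)) * (1 - c * (1 - F1 y1)) / (1 - c * upper_mass y1 y2)"
    proof (rule quotient_mono)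
      have "c * (upper_mass y1 x2 - upper_mass y1 y2) \<le> c * (F2 y2 - F2 x2)"
        using upper_mass_increment2[OF L(2) le(2)] c by (intro mult_left_mono) auto
      then show "1 - c * upper_mass y1 y2 - (1 - c * upper_mass y1 x2) \<le> 1 - c * (1 - F2 y2) - (1 - c * (1 - F2 x2))"
        by (simp add: algebra_simps)
    qed (use bounds L le c marginal_mono upper_mass_antimono in \<open>auto intro: less_imp_le\<close>)
    finally show ?thesis using L by (simp add: conv_power_def eq less_eq_prod_def mult.commute)
  qed
  show "0 \<le> conv_power c (y1, y2) - conv_power c (x1, y2) - conv_power c (y1, x2) + conv_power c (x1, x2)"
    if x: "L \<le> (x1, x2)" and le: "x1 \<le> y1" "x2 \<le> y2" for x1 x2 y1 y2
  proof -
    have L: "fst L \<le> x1" "snd L \<le> x2" "fst L \<le> y1" "snd L \<le> y2"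
      using x le by (auto simp: less_eq_prod_def)
    define A B \<alpha> \<beta> where "A = 1 - c * (1 - F1 x1)" and "B = 1 - c * (1 - F2 x2)"
      and "\<alpha> = c * (F1 y1 - F1 x1)" and "\<beta> = c * (F2 y2 - F2 x2)"
    define D r s p where "D = 1 - c * upper_mass y1 y2" and "r = c * (upper_mass x1 y2 - upper_mass y1 y2)"
      and "s = c * (upper_mass y1 x2 - upper_mass y1 y2)" and "p = c * (upper_mass y1 y2 - upper_mass x1 y2 - upper_mass y1 x2 + upper_mass x1 x2)"
    have eqs: "D - r = 1 - c * upper_mass x1 y2" "D - s = 1 - c * upper_mass y1 x2" "D - r - s - p = 1 - c * upper_mass x1 x2"
      "A + \<alpha> = 1 - c * (1 - F1 y1)" "B + \<beta> = 1 - c * (1 - F2 y2)"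
      by (simp_all add: A_def B_def \<alpha>_def \<beta>_def D_def r_def s_def p_def algebra_simps)
    have "0 \<le> (A + \<alpha>) * (B + \<beta>) / D - A * (B + \<beta>) / (D - r) - (A + \<alpha>) * B / (D - s)
      + A * B / (D - r - s - p)"
    proof (rule quotient_quasi_monotone)
      show "0 \<le> A" "0 \<le> B" using conv_power_bounds(3)[of x1] conv_power_bounds(4)[of x2]
        by (simp_all add: A_def B_def)
      show "0 \<le> r" "0 \<le> s" using c upper_mass_antimono le by (simp_all add: r_def s_def)
      show "0 \<le> p" using c upper_mass_quasi[OF le] by (simp add: p_def)
      show "0 < D - r - s - p" unfolding eqs(3) by (rule conv_power_bounds(5)[OF L(1)])
      show "r \<le> \<alpha>" unfolding r_def \<alpha>_def
        using upper_mass_increment1[OF L(1) le(1)] c by (intro mult_left_mono) auto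
      show "s \<le> \<beta>" unfolding s_def \<beta>_def
        using upper_mass_increment2[OF L(2) le(2)] c by (intro mult_left_mono) auto
      show "A \<le> D - r" unfolding eqs A_def by (rule conv_power_bounds(1)[OF L(1)])
      show "B \<le> D - s" unfolding eqs B_def by (rule conv_power_bounds(2)[OF L(2)])
    qed
    then show ?thesis using L unfolding eqs(3) unfolding eqs(1,2,4,5)
      by (simp add: conv_power_def less_eq_prod_def A_def B_def D_def)
  qed
  show "(\<lambda>n. conv_power c (real n, real n)) \<longlonglongrightarrow> 1"
  proof (rule Lim_transform_eventually)
    have k0: "(\<lambda>n. upper_mass (real n) (real n)) \<longlonglongrightarrow> 0"
    proof (rule tendsto_sandwich[OF _ _ tendsto_const])
      show "\<forall>\<^sub>F n in sequentially. upper_mass (real n) (real n) \<le> 1 - F1 (real n)"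
        using eventually_real_gt[of "fst L"] by eventually_elim (simp add: upper_mass_le_marginal1)
      show "(\<lambda>n. 1 - F1 (real n)) \<longlonglongrightarrow> 0"
        using tendsto_diff[OF tendsto_const marginals_lim_1(1), of 1] by simp
    qed (simp add: upper_mass_nonneg)
    have "(\<lambda>n. (1 - c * (1 - F1 (real n))) * (1 - c * (1 - F2 (real n))) / (1 - c * upper_mass (real n) (real n)))
      \<longlonglongrightarrow> (1 - c * (1 - 1)) * (1 - c * (1 - 1)) / (1 - c * 0)"
      by (intro tendsto_intros marginals_lim_1 k0) auto
    then show "(\<lambda>n. (1 - c * (1 - F1 (real n))) * (1 - c * (1 - F2 (real n))) / (1 - c * upper_mass (real n) (real n)))
      \<longlonglongrightarrow> 1" by simp
    show "\<forall>\<^sub>F n in sequentially. (1 - c * (1 - F1 (real n))) * (1 - c * (1 - F2 (real n))) /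
        (1 - c * upper_mass (real n) (real n)) = conv_power c (real n, real n)"
      using eventually_real_gt[of "fst L"] eventually_real_gt[of "snd L"]
      by eventually_elim (simp add: conv_power_def less_eq_prod_def)
  qed
  show "(\<lambda>m. conv_power c (up m x)) \<longlonglongrightarrow> conv_power c x" if "L \<le> x" for x
  proof -
    have "L \<le> up m x" for m using that up_ge(1) order_trans by blast
    moreover have "(\<lambda>m. (1 - c * (1 - F1 (fst (up m x)))) * (1 - c * (1 - F2 (snd (up m x)))) /
        (1 - c * upper_mass (fst (up m x)) (snd (up m x)))) \<longlonglongrightarrow>
        (1 - c * (1 - F1 (fst x))) * (1 - c * (1 - F2 (snd x))) / (1 - c * upper_mass (fst x) (snd x))"
    proof (intro tendsto_intros upper_mass_right)
      show "1 - c * upper_mass (fst x) (snd x) \<noteq> 0"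
        using conv_power_bounds(5)[of "fst x" "snd x"] that by (simp add: less_eq_prod_def)
    qed (auto simp: up_def intro: marginal_right_continuous simp del: of_nat_Suc)
    ultimately show ?thesis using that by (simp add: conv_power_def)
  qed
qed

interpretation K: planar_distribution "df_measure (conv_power c)" "conv_power c"
  by (rule planar_distribution_df_measure[OF bivariate_df_conv_power])

lemma marginal1_conv_power: "marginal1 (conv_power c) a = (if fst L \<le> a then 1 - c * (1 - F1 a) else 0)"
proof (rule LIMSEQ_unique[OF K.lim_marginal1])
  show "(\<lambda>n. conv_power c (a, real n)) \<longlonglongrightarrow> (if fst L \<le> a then 1 - c * (1 - F1 a) else 0)"
  proof (cases "fst L \<le> a")
    case True
    have k0: "(\<lambda>n. upper_mass a (real n)) \<longlonglongrightarrow> 0"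
    proof (rule tendsto_sandwich[OF _ _ tendsto_const])
      show "\<forall>\<^sub>F n in sequentially. upper_mass a (real n) \<le> 1 - F2 (real n)"
        using eventually_real_gt[of "snd L"] by eventually_elim (simp add: upper_mass_le_marginal2)
      show "(\<lambda>n. 1 - F2 (real n)) \<longlonglongrightarrow> 0"
        using tendsto_diff[OF tendsto_const marginals_lim_1(2), of 1] by simp
    qed (simp add: upper_mass_nonneg)
    have "(\<lambda>n. (1 - c * (1 - F1 a)) * (1 - c * (1 - F2 (real n))) / (1 - c * upper_mass a (real n)))
      \<longlonglongrightarrow> (1 - c * (1 - F1 a)) * (1 - c * (1 - 1)) / (1 - c * 0)"
      by (intro tendsto_intros marginals_lim_1 k0) auto
    moreover have "\<forall>\<^sub>F n in sequentially. (1 - c * (1 - F1 a)) * (1 - c * (1 - F2 (real n))) /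
        (1 - c * upper_mass a (real n)) = conv_power c (a, real n)"
      using eventually_real_gt[of "snd L"]
      by eventually_elim (use True in \<open>simp add: conv_power_def less_eq_prod_def\<close>)
    ultimately show ?thesis using True by (auto dest: Lim_transform_eventually)
  qed (simp add: conv_power_def less_eq_prod_def)
qed

lemma marginal2_conv_power: "marginal2 (conv_power c) b = (if snd L \<le> b then 1 - c * (1 - F2 b) else 0)"
proof (rule LIMSEQ_unique[OF K.lim_marginal2])
  show "(\<lambda>n. conv_power c (real n, b)) \<longlonglongrightarrow> (if snd L \<le> b then 1 - c * (1 - F2 b) else 0)"
  proof (cases "snd L \<le> b")
    case True
    have k0: "(\<lambda>n. upper_mass (real n) b) \<longlonglongrightarrow> 0"
    proof (rule tendsto_sandwich[OF _ _ tendsto_const])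
      show "\<forall>\<^sub>F n in sequentially. upper_mass (real n) b \<le> 1 - F1 (real n)"
        using eventually_real_gt[of "fst L"] by eventually_elim (simp add: upper_mass_le_marginal1)
      show "(\<lambda>n. 1 - F1 (real n)) \<longlonglongrightarrow> 0"
        using tendsto_diff[OF tendsto_const marginals_lim_1(1), of 1] by simp
    qed (simp add: upper_mass_nonneg)
    have "(\<lambda>n. (1 - c * (1 - F1 (real n))) * (1 - c * (1 - F2 b)) / (1 - c * upper_mass (real n) b))
      \<longlonglongrightarrow> (1 - c * (1 - 1)) * (1 - c * (1 - F2 b)) / (1 - c * 0)"
      by (intro tendsto_intros marginals_lim_1 k0) auto
    moreover have "\<forall>\<^sub>F n in sequentially. (1 - c * (1 - F1 (real n))) * (1 - c * (1 - F2 b)) /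
        (1 - c * upper_mass (real n) b) = conv_power c (real n, b)"
      using eventually_real_gt[of "fst L"]
      by eventually_elim (use True in \<open>simp add: conv_power_def less_eq_prod_def\<close>)
    ultimately show ?thesis using True by (auto dest: Lim_transform_eventually)
  qed (simp add: conv_power_def less_eq_prod_def)
qed

lemma Q_conv_power:
  assumes "L \<le> x" shows "Q_fun (conv_power c) x = 1 - c * upper_mass (fst x) (snd x)"
proof -
  have "fst L \<le> fst x" "snd L \<le> snd x" using assms by (auto simp: less_eq_prod_def)
  then show ?thesis
    using conv_power_bounds(3)[of "fst x"] conv_power_bounds(4)[of "snd x"]
    by (simp add: Q_fun_def marginal1_conv_power marginal2_conv_power conv_power_def assms)
qed

end

text \<open>The three coordinates are linear in the exponent, so exponents add. The result is stated for
  any \<open>G\<close> with the right margins and the right \<open>Q_fun\<close>, in order to cover \<open>F\<close> itself (\<open>c + d = 1\<close>), which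
  may vanish on the boundary of the quadrant above \<open>L\<close>.\<close>

lemma bifree_max_conv_conv_power:
  assumes c: "0 < c" "0 < d" "c + d \<le> 1"
    and G: "bivariate_df G"
      "\<And>a. marginal1 G a = (if fst L \<le> a then 1 - (c + d) * (1 - F1 a) else 0)"
      "\<And>b. marginal2 G b = (if snd L \<le> b then 1 - (c + d) * (1 - F2 b) else 0)"
    and pos: "\<And>x. L \<le> x \<Longrightarrow> 0 < marginal1 G (fst x) \<Longrightarrow> 0 < marginal2 G (snd x) \<Longrightarrow>
      Q_fun G x = 1 - (c + d) * upper_mass (fst x) (snd x)"
    and zero: "\<And>x. \<not> (L \<le> x \<and> 0 < marginal1 G (fst x) \<and> 0 < marginal2 G (snd x)) \<Longrightarrow> G x = 0"
  shows "bifree_max_conv (conv_power c) (conv_power d) G"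
proof -
  have c1: "c < 1" "d < 1" using c by auto
  have *: "0 \<le> 1 - (c + d) * (1 - t)" if "0 \<le> t" "t \<le> 1" for t
  proof -
    have "(c + d) * (1 - t) \<le> 1 * 1" using that c by (intro mult_mono) auto
    then show ?thesis by simp
  qed
  have iff: "0 < conv_power c x \<and> 0 < conv_power d x \<longleftrightarrow> L \<le> x" for x
    using conv_power_pos[OF c(1) c1(1)] conv_power_pos[OF c(2) c1(2)] by (auto simp: conv_power_def)
  show ?thesis
    unfolding bifree_max_conv_def
  proof (intro conjI allI)
    show "bivariate_df (conv_power c)" "bivariate_df (conv_power d)"
      using bivariate_df_conv_power c c1 by auto
    show "marginal1 G t = max (marginal1 (conv_power c) t + marginal1 (conv_power d) t - 1) 0" for t
      using *[of "F1 t"] marginal_nonneg(1)[of t] marginal_le_1(1)[of t]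
      by (simp add: G marginal1_conv_power c c1 algebra_simps max_def)
    show "marginal2 G t = max (marginal2 (conv_power c) t + marginal2 (conv_power d) t - 1) 0" for t
      using *[of "F2 t"] marginal_nonneg(2)[of t] marginal_le_1(2)[of t]
      by (simp add: G marginal2_conv_power c c1 algebra_simps max_def)
    fix x
    show "if 0 < conv_power c x \<and> 0 < conv_power d x \<and> 0 < marginal1 G (fst x) \<and> 0 < marginal2 G (snd x)
      then Q_fun G x = Q_fun (conv_power c) x + Q_fun (conv_power d) x - 1 else G x = 0"
    proof (cases "L \<le> x \<and> 0 < marginal1 G (fst x) \<and> 0 < marginal2 G (snd x)")
      case True
      then show ?thesis using pos[of x] iff[of x] Q_conv_power[OF c(1) c1(1), of x] Q_conv_power[OF c(2) c1(2), of x]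
        by (simp add: algebra_simps)
    next
      case False
      then show ?thesis using zero[OF False] iff[of x] by auto
    qed
  qed (rule G)
qed

lemma bifree_max_power_conv_power:
  assumes "2 \<le> n" "1 \<le> m" "m < n"
  shows "bifree_max_power (conv_power (1 / real n)) m (conv_power (real m / real n))"
  using assms(2,3)
proof (induction m rule: dec_induct)
  case base
  then show ?case using assms(1)
    by (simp add: bifree_max_power.one[simplified] bivariate_df_conv_power)
next
  case (step m)
  let ?c = "real m / real n + 1 / real n"
  have c: "0 < real m / real n" "0 < 1 / real n" "?c < 1" "?c = real (Suc m) / real n" "0 < ?c"
    using step assms(1) by (auto simp: field_simps intro: add_pos_pos)
  have "bifree_max_conv (conv_power (real m / real n)) (conv_power (1 / real n)) (conv_power ?c)"
  proof (rule bifree_max_conv_conv_power)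
    show "conv_power ?c x = 0"
      if "\<not> (L \<le> x \<and> 0 < marginal1 (conv_power ?c) (fst x) \<and> 0 < marginal2 (conv_power ?c) (snd x))" for x
    proof (cases "L \<le> x")
      case True
      then have "0 < marginal1 (conv_power ?c) (fst x) \<and> 0 < marginal2 (conv_power ?c) (snd x)"
        using conv_power_bounds(3,4)[of ?c] c by (simp add: marginal1_conv_power marginal2_conv_power less_eq_prod_def)
      then show ?thesis using that True by simp
    qed (simp add: conv_power_def)
    show "bivariate_df (conv_power ?c)"
      "\<And>a. marginal1 (conv_power ?c) a = (if fst L \<le> a then 1 - ?c * (1 - F1 a) else 0)"
      "\<And>b. marginal2 (conv_power ?c) b = (if snd L \<le> b then 1 - ?c * (1 - F2 b) else 0)"
      "\<And>x. L \<le> x \<Longrightarrow> Q_fun (conv_power ?c) x = 1 - ?c * upper_mass (fst x) (snd x)"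
      using bivariate_df_conv_power[OF c(5,3)] marginal1_conv_power[OF c(5,3)]
        marginal2_conv_power[OF c(5,3)] Q_conv_power[OF c(5,3)] by blast+
  qed (use c in auto)
  then show ?case using step bifree_max_power.Suc c(4) by fastforce
qed

text \<open>For \<open>n \<ge> 2\<close> the root is \<open>conv_power (1 / n)\<close>; the last of the convolutions leads from
  \<open>conv_power ((n - 1) / n)\<close> to \<open>F\<close>. For \<open>n = 1\<close> the root is \<open>F\<close> itself.\<close>

lemma bifree_max_inf_div: "bifree_max_inf_div F"
  unfolding bifree_max_inf_div_def
proof (intro allI impI)
  fix n :: nat assume n: "1 \<le> n"
  show "\<exists>G. bivariate_df G \<and> bifree_max_power G n F"
  proof (cases "n = 1")
    case True
    then show ?thesis using bivariate bifree_max_power.one[OF bivariate] by auto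
  next
    case False
    then obtain m where m: "n = Suc m" "1 \<le> m" "m < n" "2 \<le> n" using n by (cases n) auto
    define c d where "c = real m / real n" and "d = 1 / real n"
    have c: "0 < c" "0 < d" "d < 1" "c + d = 1" using m by (auto simp: c_def d_def field_simps)
    have "bifree_max_conv (conv_power c) (conv_power d) F"
    proof (rule bifree_max_conv_conv_power)
      show "marginal1 F a = (if fst L \<le> a then 1 - (c + d) * (1 - F1 a) else 0)" for a
        by (simp add: c marginal1_zero)
      show "marginal2 F a = (if snd L \<le> a then 1 - (c + d) * (1 - F2 a) else 0)" for a
        by (simp add: c marginal2_zero)
      show "Q_fun F x = 1 - (c + d) * upper_mass (fst x) (snd x)" if "0 < F1 (fst x)" "0 < F2 (snd x)" for x
        using Q_eq[of "fst x" "snd x"] that pos_iff[of "fst x" "snd x"] by (simp add: c)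
      show "F x = 0" if "\<not> (L \<le> x \<and> 0 < F1 (fst x) \<and> 0 < F2 (snd x))" for x
        using that pos_iff[of "fst x" "snd x"] pos_ge[of x] nonneg[of x] by (auto simp: less_le)
    qed (use c bivariate in auto)
    moreover have "bifree_max_power (conv_power d) m (conv_power c)"
      unfolding c_def d_def by (rule bifree_max_power_conv_power) (use m in auto)
    ultimately have "bifree_max_power (conv_power d) n F"
      unfolding m(1) by (rule bifree_max_power.Suc[rotated])
    then show ?thesis using bivariate_df_conv_power[OF c(2,3)] by blast
  qed
qed

end

section \<open>Monotonicity from convolution roots\<close>

lemma rectangle_corners:
  fixes x1 x2 y1 y2 :: real
  assumes "x1 \<le> y1 \<and> x2 \<le> y2 \<and> {x1..y1} \<times> {x2..y2} \<subseteq> {x. P x}"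
  shows "P (y1, y2)" "P (x1, y2)" "P (y1, x2)" "P (x1, x2)"
proof -
  have "(u, v) \<in> {x. P x}" if "u \<in> {x1..y1}" "v \<in> {x2..y2}" for u v
    using assms that by blast
  then show "P (y1, y2)" "P (x1, y2)" "P (y1, x2)" "P (x1, x2)" using assms by auto
qed

text \<open>Where the result of a convolution is positive, both factors are positive and no truncation
  takes place; so the three coordinates are multiplied by \<open>n\<close>.\<close>

lemma bifree_max_power_facts:
  assumes "bifree_max_power G n K"
  shows "bivariate_df G" "bivariate_df K"
    and "0 < K x \<Longrightarrow> 0 < G x \<and> Q_fun K x = real n * (Q_fun G x - 1) + 1 \<and>
      marginal1 K (fst x) = real n * (marginal1 G (fst x) - 1) + 1 \<and>
      marginal2 K (snd x) = real n * (marginal2 G (snd x) - 1) + 1"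
proof -
  have "bivariate_df G \<and> bivariate_df K \<and> (0 < K x \<longrightarrow> 0 < G x \<and>
      Q_fun K x = real n * (Q_fun G x - 1) + 1 \<and>
      marginal1 K (fst x) = real n * (marginal1 G (fst x) - 1) + 1 \<and>
      marginal2 K (snd x) = real n * (marginal2 G (snd x) - 1) + 1)"
    using assms
  proof induction
    case (Suc n K H)
    have "0 < G x \<and> Q_fun H x = real (Suc n) * (Q_fun G x - 1) + 1 \<and>
      marginal1 H (fst x) = real (Suc n) * (marginal1 G (fst x) - 1) + 1 \<and>
      marginal2 H (snd x) = real (Suc n) * (marginal2 G (snd x) - 1) + 1" if H: "0 < H x"
    proof -
      have conv: "if 0 < K x \<and> 0 < G x \<and> 0 < marginal1 H (fst x) \<and> 0 < marginal2 H (snd x)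
          then Q_fun H x = Q_fun K x + Q_fun G x - 1 else H x = 0"
        and max: "marginal1 H (fst x) = max (marginal1 K (fst x) + marginal1 G (fst x) - 1) 0"
          "marginal2 H (snd x) = max (marginal2 K (snd x) + marginal2 G (snd x) - 1) 0"
        using Suc.hyps(2) unfolding bifree_max_conv_def by blast+
      from conv H have c: "0 < K x" "0 < G x" "0 < marginal1 H (fst x)" "0 < marginal2 H (snd x)"
        "Q_fun H x = Q_fun K x + Q_fun G x - 1"
        by (auto split: if_splits)
      from max c(3,4) have "marginal1 H (fst x) = marginal1 K (fst x) + marginal1 G (fst x) - 1"
        "marginal2 H (snd x) = marginal2 K (snd x) + marginal2 G (snd x) - 1"
        by (auto simp: max_def split: if_splits)
      then show ?thesis using c Suc.IH by (simp add: algebra_simps)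
    qed
    moreover have "bivariate_df H" using Suc.hyps(2) by (simp add: bifree_max_conv_def)
    ultimately show ?case using Suc.IH by simp
  qed simp
  then show "bivariate_df G" "bivariate_df K"
    and "0 < K x \<Longrightarrow> 0 < G x \<and> Q_fun K x = real n * (Q_fun G x - 1) + 1 \<and>
      marginal1 K (fst x) = real n * (marginal1 G (fst x) - 1) + 1 \<and>
      marginal2 K (snd x) = real n * (marginal2 G (snd x) - 1) + 1" by auto
qed

text \<open>The \<open>n\<close>-th root equals \<open>(1 + f1 / n) (1 + f2 / n) / (1 + q / n)\<close> with \<open>f1 = F\<^sub>1 - 1\<close>,
  \<open>f2 = F\<^sub>2 - 1\<close> and \<open>q = Q - 1\<close>, whose first-order term is \<open>(f1 + f2 - q) / n = - T / n\<close>.\<close>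

lemma bifree_root_limit:
  assumes root: "\<And>n. 1 \<le> n \<Longrightarrow> bifree_max_power (G n) n F" and x: "0 < F x"
  shows "(\<lambda>n. real n * (G n x - 1)) \<longlonglongrightarrow> - T_fun F x"
proof -
  define f1 f2 q where "f1 = marginal1 F (fst x) - 1" and "f2 = marginal2 F (snd x) - 1"
    and "q = Q_fun F x - 1"
  have z: "(\<lambda>n. c / real n) \<longlonglongrightarrow> 0" for c by (rule lim_const_over_n)
  have lim: "(\<lambda>n. (f1 + f2 + f1 * f2 / real n - q) / (1 + q / real n)) \<longlonglongrightarrow> (f1 + f2 + 0 - q) / (1 + 0)"
    by (intro tendsto_intros z) auto
  have limit_eq: "(f1 + f2 + 0 - q) / (1 + 0) = - T_fun F x"
    by (simp add: f1_def f2_def q_def T_fun_def Q_fun_def)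
  have "\<forall>\<^sub>F n in sequentially.
      (f1 + f2 + f1 * f2 / real n - q) / (1 + q / real n) = real n * (G n x - 1)"
    using eventually_ge_at_top[of 1]
  proof eventually_elim
    case (elim n)
    note facts = bifree_max_power_facts[OF root[OF elim]]
    interpret G: planar_distribution "df_measure (G n)" "G n"
      by (rule planar_distribution_df_measure[OF facts(1)])
    have pos: "0 < G n x" using facts(3)[OF x] by blast
    have n: "0 < real n" using elim by simp
    have m: "marginal1 (G n) (fst x) = 1 + f1 / real n" "marginal2 (G n) (snd x) = 1 + f2 / real n"
      "Q_fun (G n) x = 1 + q / real n"
      using facts(3)[OF x] n by (auto simp: f1_def f2_def q_def field_simps)
    have p: "0 < 1 + f1 / real n" "0 < 1 + f2 / real n"
      using pos G.le_marginal1[of "fst x" "snd x"] G.le_marginal2[of "fst x" "snd x"] m by auto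
    then have Q: "0 < 1 + q / real n"
      using m pos by (simp flip: m(3) add: Q_fun_def)
    have "(1 + f1 / real n) * (1 + f2 / real n) / G n x = 1 + q / real n"
      using m by (simp add: Q_fun_def)
    then have G: "G n x = (1 + f1 / real n) * (1 + f2 / real n) / (1 + q / real n)"
      using pos Q p by (metis divide_divide_eq_right nonzero_mult_div_cancel_left
          less_irrefl mult_pos_pos nonzero_eq_divide_eq mult.commute)
    have "real n * (G n x - 1) = real n * ((1 + f1 / real n) * (1 + f2 / real n) - (1 + q / real n)) / (1 + q / real n)"
      unfolding G using Q by (simp add: diff_divide_distrib right_diff_distrib)
    also have "real n * ((1 + f1 / real n) * (1 + f2 / real n) - (1 + q / real n)) = f1 + f2 + f1 * f2 / real n - q"
      using n by (simp add: field_simps)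
    finally show ?case by simp
  qed
  from Lim_transform_eventually[OF lim this] show ?thesis unfolding limit_eq .
qed

context rectangular_distribution
begin

lemma inf_div_imp_T_monotone:
  assumes "bifree_max_inf_div F"
  shows "mono_on {x. 0 < F x} (\<lambda>x. - T_fun F x)" "quasi_monotone_on {x. 0 < F x} (\<lambda>x. - T_fun F x)"
proof -
  obtain G where G: "\<And>n. 1 \<le> n \<Longrightarrow> bifree_max_power (G n) n F"
    using assms unfolding bifree_max_inf_div_def by metis
  have lim: "(\<lambda>n. real n * (G n x - 1)) \<longlonglongrightarrow> - T_fun F x" if "0 < F x" for x
    by (rule bifree_root_limit[OF G that])
  have dist: "planar_distribution (df_measure (G n)) (G n)" if "1 \<le> n" for n
    by (rule planar_distribution_df_measure[OF bifree_max_power_facts(1)[OF G[OF that]]])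
  show "mono_on {x. 0 < F x} (\<lambda>x. - T_fun F x)"
  proof (rule mono_onI)
    fix x y assume xy: "x \<in> {x. 0 < F x}" "y \<in> {x. 0 < F x}" "x \<le> y"
    show "- T_fun F x \<le> - T_fun F y"
    proof (rule LIMSEQ_le)
      show "(\<lambda>n. real n * (G n x - 1)) \<longlonglongrightarrow> - T_fun F x"
        "(\<lambda>n. real n * (G n y - 1)) \<longlonglongrightarrow> - T_fun F y" using xy by (auto intro: lim)
      show "\<exists>N. \<forall>n\<ge>N. real n * (G n x - 1) \<le> real n * (G n y - 1)"
      proof (intro exI[of _ 1] allI impI)
        fix n :: nat assume n: "1 \<le> n"
        show "real n * (G n x - 1) \<le> real n * (G n y - 1)"
          using planar_distribution.mono[OF dist[OF n] xy(3)] by (intro mult_left_mono) auto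
      qed
    qed
  qed
  show "quasi_monotone_on {x. 0 < F x} (\<lambda>x. - T_fun F x)"
    unfolding quasi_monotone_on_def
  proof (intro allI impI)
    fix x1 x2 y1 y2
    assume *: "x1 \<le> y1 \<and> x2 \<le> y2 \<and> {x1..y1} \<times> {x2..y2} \<subseteq> {x. 0 < F x}"
    then have pos: "0 < F (y1, y2)" "0 < F (x1, y2)" "0 < F (y1, x2)" "0 < F (x1, x2)" by (rule rectangle_corners)+
    show "0 \<le> - T_fun F (y1, y2) - - T_fun F (x1, y2) - - T_fun F (y1, x2) + - T_fun F (x1, x2)"
    proof (rule LIMSEQ_le_const[OF tendsto_add[OF tendsto_diff[OF tendsto_diff[OF
              lim[OF pos(1)] lim[OF pos(2)]] lim[OF pos(3)]] lim[OF pos(4)]]],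
          intro exI[of _ 1] allI impI)
        fix n :: nat assume n: "1 \<le> n"
        have "0 \<le> real n * (G n (y1, y2) - G n (x1, y2) - G n (y1, x2) + G n (x1, x2))"
          using planar_distribution.quasi[OF dist[OF n]] * by simp
        then show "0 \<le> real n * (G n (y1, y2) - 1) - real n * (G n (x1, y2) - 1) -
            real n * (G n (y1, x2) - 1) + real n * (G n (x1, x2) - 1)"
          by (simp add: algebra_simps)
    qed
  qed
qed

lemma Quad_subset: "Quad \<subseteq> {x. 0 < F x}"
  using pos_Quad by auto

lemma represented_distributionI:
  assumes "T_representation F H lam"
  shows "represented_distribution \<mu> F L (df_measure H) H lam"
proof -
  interpret H: planar_distribution "df_measure H" H
    by (rule planar_distribution_df_measure) (use assms in \<open>simp add: T_representation_def\<close>)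
  show ?thesis
    by unfold_locales (use assms in \<open>auto simp: T_representation_def\<close>)
qed

end

section \<open>Consequences of a representing distribution\<close>

text \<open>Every point above \<open>x\<close> and close to \<open>x\<close> lies between \<open>x\<close> and \<open>up m x\<close>.\<close>

lemma continuous_from_above_onI:
  fixes K :: "real \<times> real \<Rightarrow> real"
  assumes mono: "\<And>x y. x \<le> y \<Longrightarrow> K x \<le> K y" and right: "\<And>x. (\<lambda>m. K (up m x)) \<longlonglongrightarrow> K x"
  shows "(K \<longlongrightarrow> K x) (at x within {y \<in> S. x \<le> y})"
proof (rule order_tendstoI)
  fix e assume "e < K x"
  then show "\<forall>\<^sub>F y in at x within {y \<in> S. x \<le> y}. e < K y"
    by (auto simp: eventually_at_filter intro!: always_eventually dest!: mono)
next
  fix e assume "K x < e"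
  then obtain m where m: "K (up m x) < e"
    using order_tendstoD(2)[OF right] eventually_happens'[OF sequentially_bot] by blast
  have "open ({..<fst (up m x)} \<times> {..<snd (up m x)})" by (intro open_Times) auto
  moreover have "x \<in> {..<fst (up m x)} \<times> {..<snd (up m x)}" using up_ge[of x m] by (auto simp: mem_Times_iff)
  ultimately have "\<forall>\<^sub>F y in nhds x. y \<in> {..<fst (up m x)} \<times> {..<snd (up m x)}"
    by (rule eventually_nhds_in_open)
  then show "\<forall>\<^sub>F y in at x within {y \<in> S. x \<le> y}. K y < e"
    unfolding eventually_at_filter
  proof eventually_elim
    case (elim y)
    then have "y \<le> up m x" by (auto simp: mem_Times_iff less_eq_prod_def)
    then show ?case using mono[of y "up m x"] m by auto
  qed
qed

context represented_distribution
begin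

lemma Q_conditions:
  "quasi_monotone_on {x. 0 < F x} (\<lambda>x. - Q_fun F x)"
  "0 < F x \<Longrightarrow> 0 < F y \<Longrightarrow> x \<le> y \<Longrightarrow> 0 \<le> Q_fun F y - Q_fun F x \<and>
     Q_fun F y - Q_fun F x \<le> marginal1 F (fst y) - marginal1 F (fst x)
       + marginal2 F (snd y) - marginal2 F (snd x)"
proof -
  show "quasi_monotone_on {x. 0 < F x} (\<lambda>x. - Q_fun F x)"
    unfolding quasi_monotone_on_def
  proof (intro allI impI)
    fix x1 x2 y1 y2
    assume *: "x1 \<le> y1 \<and> x2 \<le> y2 \<and> {x1..y1} \<times> {x2..y2} \<subseteq> {x. 0 < F x}"
    then have pos: "0 < F (y1, y2)" "0 < F (x1, y2)" "0 < F (y1, x2)" "0 < F (x1, x2)" by (rule rectangle_corners)+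
    show "0 \<le> - Q_fun F (y1, y2) - - Q_fun F (x1, y2) - - Q_fun F (y1, x2) + - Q_fun F (x1, x2)"
      using upper_mass_quasi[of x1 y1 x2 y2] * by (simp add: Q_eq pos)
  qed
  assume x: "0 < F x" and y: "0 < F y" and xy: "x \<le> y"
  have "Q_fun F x = 1 - upper_mass (fst x) (snd x)" "Q_fun F y = 1 - upper_mass (fst y) (snd y)"
    using Q_eq[of "fst x" "snd x"] Q_eq[of "fst y" "snd y"] x y by auto
  moreover have "upper_mass (fst y) (snd y) \<le> upper_mass (fst x) (snd x)"
    using xy by (intro upper_mass_antimono) (auto simp: less_eq_prod_def)
  moreover have "T_fun F y \<le> T_fun F x"
    using T_eq[OF x] T_eq[OF y] H.mono[OF xy] lam_pos by simp
  then have "Q_fun F y - Q_fun F x \<le> marginal1 F (fst y) - marginal1 F (fst x)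
       + marginal2 F (snd y) - marginal2 F (snd x)"
    by (simp add: T_fun_def Q_fun_def)
  ultimately show "0 \<le> Q_fun F y - Q_fun F x \<and>
     Q_fun F y - Q_fun F x \<le> marginal1 F (fst y) - marginal1 F (fst x)
       + marginal2 F (snd y) - marginal2 F (snd x)" by simp
qed

lemma T_conditions:
  "mono_on {x. 0 < F x} (\<lambda>x. - T_fun F x)"
  "continuous_from_above_on {x. 0 < F x} (\<lambda>x. - T_fun F x)"
  "quasi_monotone_on {x. 0 < F x} (\<lambda>x. - T_fun F x)"
proof -
  show "mono_on {x. 0 < F x} (\<lambda>x. - T_fun F x)"
    using lam_pos by (auto intro!: mono_onI H.mono simp: T_eq)
  show "quasi_monotone_on {x. 0 < F x} (\<lambda>x. - T_fun F x)"
    unfolding quasi_monotone_on_def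
  proof (intro allI impI)
    fix x1 x2 y1 y2
    assume *: "x1 \<le> y1 \<and> x2 \<le> y2 \<and> {x1..y1} \<times> {x2..y2} \<subseteq> {x. 0 < F x}"
    then have pos: "0 < F (y1, y2)" "0 < F (x1, y2)" "0 < F (y1, x2)" "0 < F (x1, x2)" by (rule rectangle_corners)+
    have "0 \<le> lam * (H (y1, y2) - H (x1, y2) - H (y1, x2) + H (x1, x2))"
      using H.quasi * lam_pos by simp
    then show "0 \<le> - T_fun F (y1, y2) - - T_fun F (x1, y2) - - T_fun F (y1, x2) + - T_fun F (x1, x2)"
      by (simp add: T_eq pos algebra_simps)
  qed
  show "continuous_from_above_on {x. 0 < F x} (\<lambda>x. - T_fun F x)"
    unfolding continuous_from_above_on_def
  proof
    fix x assume x: "x \<in> {x. 0 < F x}"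
    have "(H \<longlongrightarrow> H x) (at x within {y \<in> {x. 0 < F x}. x \<le> y})"
      by (rule continuous_from_above_onI[OF H.mono H.right_continuous])
    then have "((\<lambda>y. - (lam * (1 - H y))) \<longlongrightarrow> - (lam * (1 - H x))) (at x within {y \<in> {x. 0 < F x}. x \<le> y})"
      by (intro tendsto_intros)
    then show "((\<lambda>x. - T_fun F x) \<longlongrightarrow> - T_fun F x) (at x within {y \<in> {x. 0 < F x}. x \<le> y})"
    proof (rule Lim_transform_eventually[THEN back_subst[of "\<lambda>l. filterlim _ (nhds l) _"]])
      show "\<forall>\<^sub>F y in at x within {y \<in> {x. 0 < F x}. x \<le> y}. - (lam * (1 - H y)) = - T_fun F y"
        by (auto simp: eventually_at_filter T_eq)
      show "- (lam * (1 - H x)) = - T_fun F x" using x by (simp add: T_eq)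
    qed
  qed
qed

lemma tau_representation_scaled: "tau_representation F L (scale_measure (ennreal lam) \<nu>)"
  unfolding tau_representation_def
proof (intro conjI allI impI)
  show "sets (scale_measure (ennreal lam) \<nu>) = sets borel" by simp
  show "emeasure (scale_measure (ennreal lam) \<nu>) UNIV \<noteq> 0"
    using H.emeasure_space_1 lam_pos by simp
  have rv: "fst \<in> borel_measurable (scale_measure (ennreal lam) \<nu>)"
    "snd \<in> borel_measurable (scale_measure (ennreal lam) \<nu>)"
    by (auto simp: measurable_cong_sets[OF sets_scale_measure refl])
  show "emeasure (distr (scale_measure (ennreal lam) \<nu>) borel fst) {t<..} = ennreal (1 - F1 t)"
    if "fst L < t" for t
  proof -
    have "fst -` {t<..} = {t<..} \<times> (UNIV :: real set)" by auto
    then show ?thesis using lam_pos that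
      by (simp add: emeasure_distr rv space_scale_measure H.emeasure_eq_measure H.upper1
          marginal1_rep ennreal_mult' H.marginal_le_1)
  qed
  show "emeasure (distr (scale_measure (ennreal lam) \<nu>) borel snd) {t<..} = ennreal (1 - F2 t)"
    if "snd L < t" for t
  proof -
    have "snd -` {t<..} = (UNIV :: real set) \<times> {t<..}" by auto
    then show ?thesis using lam_pos that
      by (simp add: emeasure_distr rv space_scale_measure H.emeasure_eq_measure H.upper2
          marginal2_rep ennreal_mult' H.marginal_le_1)
  qed
  fix x1 x2 assume x: "fst L < x1" "snd L < x2"
  then have F: "0 < F (x1, x2)" by (intro pos_Quad) auto
  then have "0 < F1 x1" "0 < F2 x2" by (simp_all add: pos_iff)
  moreover have "F1 x1 * F2 x2 / F (x1, x2) = 1 - upper_mass x1 x2"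
    using Q_eq[OF F] by (simp add: Q_fun_def)
  moreover have "measure (scale_measure (ennreal lam) \<nu>) ({x1<..} \<times> {x2<..}) = upper_mass x1 x2"
    using lam_pos by (simp add: upper_mass_def)
  ultimately show "F (x1, x2) = F1 x1 * F2 x2 / (1 - measure (scale_measure (ennreal lam) \<nu>) ({x1<..} \<times> {x2<..}))"
    using F by (metis divide_divide_eq_right nonzero_mult_div_cancel_left mult_pos_pos less_irrefl)
qed

text \<open>If \<open>H L = 1\<close>, then \<open>lam \<nu>\<close> has no mass beyond \<open>L\<close>, so both margins of \<open>F\<close> reach \<open>1\<close> at \<open>L\<close>. As they
  vanish before \<open>L\<close>, the distribution is concentrated at \<open>L\<close>.\<close>

lemma df_corner_less_1:
  assumes nonconst: "\<not> (\<exists>c. AE z in \<mu>. z = c)"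
  shows "H L < 1"
proof (rule ccontr)
  assume "\<not> H L < 1"
  have H1: "H1 (fst L) = 1" "H2 (snd L) = 1"
    using \<open>\<not> H L < 1\<close> H.le_marginal1[of "fst L" "snd L"] H.le_marginal2[of "fst L" "snd L"]
      H.marginal_le_1(1)[of "fst L"] H.marginal_le_1(2)[of "snd L"] by auto
  have F: "F1 (fst L) = 1" "F2 (snd L) = 1"
    using marginal1_rep[of "fst L"] marginal2_rep[of "snd L"] H1 by auto
  have le: "AE z in \<mu>. fst z \<le> fst L" "AE z in \<mu>. snd z \<le> snd L"
  proof -
    have "AE z in \<mu>. z \<in> {..fst L} \<times> UNIV" "AE z in \<mu>. z \<in> UNIV \<times> {..snd L}"
      using F by (subst (asm) marginal1_eq marginal2_eq, intro prob_eq_1[THEN iffD1]; auto intro!: borel_Times)+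
    then show "AE z in \<mu>. fst z \<le> fst L" "AE z in \<mu>. snd z \<le> snd L" by (auto simp: mem_Times_iff)
  qed
  have ge: "AE z in \<mu>. fst L \<le> fst z" "AE z in \<mu>. snd L \<le> snd z"
  proof -
    have "AE z in \<mu>. z \<notin> {..fst L - inverse (real (Suc m))} \<times> UNIV" for m
      using marginal1_zero[of "fst L - inverse (real (Suc m))"]
      by (intro prob_eq_0[THEN iffD1]) (auto simp: marginal1_eq intro!: borel_Times)
    then have "AE z in \<mu>. \<forall>m. z \<notin> {..fst L - inverse (real (Suc m))} \<times> UNIV"
      unfolding AE_all_countable ..
    then show "AE z in \<mu>. fst L \<le> fst z"
    proof eventually_elim
      case (elim z)
      have "fst L \<le> fst z + inverse (real (Suc m))" for m
        using elim[rule_format, of m] by (simp add: mem_Times_iff del: of_nat_Suc)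
      then show ?case by (rule le_of_le_inverse_Suc)
    qed
    have "AE z in \<mu>. z \<notin> UNIV \<times> {..snd L - inverse (real (Suc m))}" for m
      using marginal2_zero[of "snd L - inverse (real (Suc m))"]
      by (intro prob_eq_0[THEN iffD1]) (auto simp: marginal2_eq intro!: borel_Times)
    then have "AE z in \<mu>. \<forall>m. z \<notin> UNIV \<times> {..snd L - inverse (real (Suc m))}"
      unfolding AE_all_countable ..
    then show "AE z in \<mu>. snd L \<le> snd z"
    proof eventually_elim
      case (elim z)
      have "snd L \<le> snd z + inverse (real (Suc m))" for m
        using elim[rule_format, of m] by (simp add: mem_Times_iff del: of_nat_Suc)
      then show ?case by (rule le_of_le_inverse_Suc)
    qed
  qed
  have "AE z in \<mu>. z = L"
    using le ge by eventually_elim (simp add: prod_eq_iff)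
  then show False using nonconst by blast
qed

end

section \<open>Representing measures\<close>

lemma tau_representationD:
  assumes "tau_representation F L \<tau>"
  shows "sets \<tau> = sets borel" "emeasure \<tau> UNIV \<noteq> 0"
    and "fst L < a \<Longrightarrow> emeasure \<tau> ({a<..} \<times> UNIV) = ennreal (1 - marginal1 F a)"
    and "snd L < b \<Longrightarrow> emeasure \<tau> (UNIV \<times> {b<..}) = ennreal (1 - marginal2 F b)"
    and "fst L < a \<Longrightarrow> snd L < b \<Longrightarrow>
      F (a, b) = marginal1 F a * marginal2 F b / (1 - measure \<tau> ({a<..} \<times> {b<..}))"
proof -
  show sets: "sets \<tau> = sets borel" and "emeasure \<tau> UNIV \<noteq> 0"
    using assms by (auto simp: tau_representation_def)
  have space: "space \<tau> = UNIV" using sets_eq_imp_space_eq[OF sets] by simp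
  have rv: "fst \<in> borel_measurable \<tau>" "snd \<in> borel_measurable \<tau>"
    by (auto simp: measurable_cong_sets[OF sets refl]
        intro!: borel_measurable_continuous_onI continuous_on_fst continuous_on_snd)
  have eq: "fst -` {t<..} = {t<..} \<times> (UNIV :: real set)" "snd -` {t<..} = (UNIV :: real set) \<times> {t<..}"
    for t :: real by auto
  show "emeasure \<tau> ({a<..} \<times> UNIV) = ennreal (1 - marginal1 F a)" if "fst L < a"
  proof -
    have "emeasure (distr \<tau> borel fst) {a<..} = ennreal (1 - marginal1 F a)"
      using assms that by (simp add: tau_representation_def)
    then show ?thesis by (simp add: emeasure_distr rv space eq)
  qed
  show "emeasure \<tau> (UNIV \<times> {b<..}) = ennreal (1 - marginal2 F b)" if "snd L < b"
  proof -
    have "emeasure (distr \<tau> borel snd) {b<..} = ennreal (1 - marginal2 F b)"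
      using assms that by (simp add: tau_representation_def)
    then show ?thesis by (simp add: emeasure_distr rv space eq)
  qed
  show "fst L < a \<Longrightarrow> snd L < b \<Longrightarrow>
      F (a, b) = marginal1 F a * marginal2 F b / (1 - measure \<tau> ({a<..} \<times> {b<..}))"
    using assms by (simp add: tau_representation_def)
qed

context rectangular_distribution
begin

context
  fixes \<tau> :: "(real \<times> real) measure"
  assumes tau: "tau_representation F L \<tau>"
begin

lemmas tauD = tau_representationD[OF tau]

lemma sets_tau [simp]: "sets \<tau> = sets borel" by (rule tauD(1))

text \<open>\<open>\<tau>\<close> itself may be infinite, but half-planes to the right of or above \<open>L\<close> have finite mass.\<close>

lemma fmeasurable_tau:
  "fst L < a \<Longrightarrow> A \<subseteq> {a<..} \<times> UNIV \<Longrightarrow> A \<in> sets borel \<Longrightarrow> A \<in> fmeasurable \<tau>"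
  "snd L < b \<Longrightarrow> A \<subseteq> UNIV \<times> {b<..} \<Longrightarrow> A \<in> sets borel \<Longrightarrow> A \<in> fmeasurable \<tau>"
proof -
  have 1: "{a<..} \<times> UNIV \<in> fmeasurable \<tau>" if "fst L < a"
    by (rule fmeasurableI) (auto simp: tauD(3)[OF that] intro!: borel_Times)
  have 2: "UNIV \<times> {b<..} \<in> fmeasurable \<tau>" if "snd L < b"
    by (rule fmeasurableI) (auto simp: tauD(4)[OF that] intro!: borel_Times)
  show "fst L < a \<Longrightarrow> A \<subseteq> {a<..} \<times> UNIV \<Longrightarrow> A \<in> sets borel \<Longrightarrow> A \<in> fmeasurable \<tau>"
    by (rule fmeasurableI2[OF 1]) auto
  show "snd L < b \<Longrightarrow> A \<subseteq> UNIV \<times> {b<..} \<Longrightarrow> A \<in> sets borel \<Longrightarrow> A \<in> fmeasurable \<tau>"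
    by (rule fmeasurableI2[OF 2]) auto
qed

lemma measure_tau_marginals:
  "fst L < a \<Longrightarrow> measure \<tau> ({a<..} \<times> UNIV) = 1 - F1 a"
  "snd L < b \<Longrightarrow> measure \<tau> (UNIV \<times> {b<..}) = 1 - F2 b"
  using tauD(3)[of a] tauD(4)[of b] marginal_le_1 by (auto simp: measure_def)

lemma Q_eq_tau:
  assumes "fst L < a" "snd L < b"
  shows "Q_fun F (a, b) = 1 - measure \<tau> ({a<..} \<times> {b<..})"
proof -
  have F: "0 < F (a, b)" using assms by (intro pos_Quad) auto
  note eq = tauD(5)[OF assms]
  from F eq have "1 - measure \<tau> ({a<..} \<times> {b<..}) \<noteq> 0" by auto
  moreover have "0 < F1 a" "0 < F2 b" using F1_pos F2_pos assms by auto
  ultimately show ?thesis unfolding Q_fun_def by (subst eq) simp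
qed

text \<open>The complement of a lower quadrant is the union of two half-planes, whose
  intersection is the upper quadrant.\<close>

lemma T_eq_tau:
  assumes "fst L < a" "snd L < b"
  shows "T_fun F (a, b) = measure \<tau> (- ({..a} \<times> {..b}))" "- ({..a} \<times> {..b}) \<in> fmeasurable \<tau>"
proof -
  have S: "{a<..} \<times> UNIV \<in> fmeasurable \<tau>" "{a<..} \<times> {b<..} \<in> fmeasurable \<tau>"
    by (rule fmeasurable_tau(1)[OF assms(1)]; auto intro!: borel_Times)+
  have S': "UNIV \<times> {b<..} \<in> fmeasurable \<tau>" "{..a} \<times> {b<..} \<in> fmeasurable \<tau>"
    by (rule fmeasurable_tau(2)[OF assms(2)]; auto intro!: borel_Times)+
  have eq: "- ({..a} \<times> {..b}) = ({a<..} \<times> UNIV) \<union> ({..a} \<times> {b<..})" by auto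
  show "- ({..a} \<times> {..b}) \<in> fmeasurable \<tau>"
    unfolding eq using S S' by (intro fmeasurable.Un)
  have "measure \<tau> (({a<..} \<times> UNIV) \<union> ({..a} \<times> {b<..})) =
      measure \<tau> ({a<..} \<times> UNIV) + measure \<tau> ({..a} \<times> {b<..})"
    using S S' by (intro measure_Un_AE) auto
  moreover have "measure \<tau> (({a<..} \<times> {b<..}) \<union> ({..a} \<times> {b<..})) =
      measure \<tau> ({a<..} \<times> {b<..}) + measure \<tau> ({..a} \<times> {b<..})"
    using S S' by (intro measure_Un_AE) auto
  moreover have "({a<..} \<times> {b<..}) \<union> ({..a} \<times> {b<..}) = UNIV \<times> {b<..}" by auto
  ultimately have "measure \<tau> (- ({..a} \<times> {..b})) = (1 - F1 a) + (1 - F2 b) - measure \<tau> ({a<..} \<times> {b<..})"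
    using measure_tau_marginals assms by (simp add: eq)
  then show "T_fun F (a, b) = measure \<tau> (- ({..a} \<times> {..b}))"
    using Q_eq_tau[OF assms] by (simp add: T_fun_def Q_fun_def)
qed

text \<open>The complements of lower quadrants decrease, and the alternating sum of \<open>- T_fun F\<close>
  over the corners of a rectangle is the mass of that rectangle.\<close>

lemma tau_imp_T_monotone:
  "mono_on Quad (\<lambda>x. - T_fun F x)" "quasi_monotone_on Quad (\<lambda>x. - T_fun F x)"
proof -
  show "mono_on Quad (\<lambda>x. - T_fun F x)"
  proof (rule mono_onI)
    fix x y assume *: "x \<in> Quad" "y \<in> Quad" "x \<le> y"
    obtain x1 x2 y1 y2 where eq: "x = (x1, x2)" "y = (y1, y2)" by (cases x, cases y)
    have L: "fst L < x1" "snd L < x2" "fst L < y1" "snd L < y2" "x1 \<le> y1" "x2 \<le> y2"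
      using * by (auto simp: eq less_eq_prod_def)
    have "measure \<tau> (- ({..y1} \<times> {..y2})) \<le> measure \<tau> (- ({..x1} \<times> {..x2}))"
    proof (rule measure_mono_fmeasurable)
      show "- ({..y1} \<times> {..y2}) \<in> sets \<tau>" using L T_eq_tau(2) by (intro fmeasurableD) auto
    qed (use L T_eq_tau(2) in auto)
    then show "- T_fun F x \<le> - T_fun F y" using L by (simp add: eq T_eq_tau)
  qed
  show "quasi_monotone_on Quad (\<lambda>x. - T_fun F x)"
    unfolding quasi_monotone_on_def
  proof (intro allI impI)
    fix x1 x2 y1 y2
    assume *: "x1 \<le> y1 \<and> x2 \<le> y2 \<and> {x1..y1} \<times> {x2..y2} \<subseteq> Quad"
    then have "(x1, x2) \<in> {x1..y1} \<times> {x2..y2}" by simp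
    then have "(x1, x2) \<in> Quad" using * by blast
    then have L: "fst L < x1" "snd L < x2" "fst L < y1" "snd L < y2" "x1 \<le> y1" "x2 \<le> y2"
      using * by auto
    let ?m = "\<lambda>a b. measure \<tau> ({a<..} \<times> {b<..})"
    have 1: "?m x1 b = ?m y1 b + measure \<tau> ({x1<..y1} \<times> {b<..})" if "snd L < b" for b
    proof -
      have "{x1<..} \<times> {b<..} = ({y1<..} \<times> {b<..}) \<union> ({x1<..y1} \<times> {b<..})" using L by auto
      moreover have "measure \<tau> (({y1<..} \<times> {b<..}) \<union> ({x1<..y1} \<times> {b<..})) =
          ?m y1 b + measure \<tau> ({x1<..y1} \<times> {b<..})"
      proof (rule measure_Un_AE)
        show "{y1<..} \<times> {b<..} \<in> fmeasurable \<tau>" "{x1<..y1} \<times> {b<..} \<in> fmeasurable \<tau>"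
          by (rule fmeasurable_tau(2)[OF that]; auto intro!: borel_Times)+
      qed auto
      ultimately show ?thesis by simp
    qed
    have "measure \<tau> ({x1<..y1} \<times> {y2<..}) \<le> measure \<tau> ({x1<..y1} \<times> {x2<..})"
    proof (rule measure_mono_fmeasurable)
      show "{x1<..y1} \<times> {x2<..} \<in> fmeasurable \<tau>"
        by (rule fmeasurable_tau(2)[OF L(2)]) (auto intro!: borel_Times)
    qed (use L in \<open>auto intro!: borel_Times\<close>)
    then have "0 \<le> ?m y1 y2 - ?m x1 y2 - ?m y1 x2 + ?m x1 x2"
      using 1 L by simp
    moreover have "T_fun F (a, b) = 1 - ?m a b - F1 a - F2 b + 1" if "fst L < a" "snd L < b" for a b
      using Q_eq_tau[OF that] by (simp add: T_fun_def Q_fun_def)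
    ultimately show "0 \<le> - T_fun F (y1, y2) - - T_fun F (x1, y2) - - T_fun F (y1, x2) + - T_fun F (x1, x2)"
      using L by simp
  qed
qed

text \<open>\<open>H\<close> is the distribution function of the normalized measure. The representation of \<open>T\<close> holds on
  the open quadrant and extends to the rest of \<open>{F > 0}\<close> by right continuity.\<close>

lemma finite_tau_imp_T_representation:
  assumes fin: "emeasure \<tau> UNIV < \<infinity>"
  shows "\<exists>H lam. T_representation F H lam \<and> \<tau> = scale_measure (ennreal lam) (df_measure H)"
proof -
  define lam where "lam = measure \<tau> UNIV"
  have lam: "emeasure \<tau> UNIV = ennreal lam" using fin by (simp add: lam_def emeasure_eq_ennreal_measure)
  have space: "space \<tau> = UNIV" using sets_eq_imp_space_eq[OF sets_tau] by simp
  interpret tau: finite_measure \<tau> by (rule finite_measureI) (use fin space in auto)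
  have lam_pos: "0 < lam" using tauD(2) lam by (cases "lam = 0") (auto simp: lam_def less_le)
  define \<nu> where "\<nu> = scale_measure (ennreal (1 / lam)) \<tau>"
  define H where "H x = measure \<nu> ({..fst x} \<times> {..snd x})" for x
  have tau_eq: "\<tau> = scale_measure (ennreal lam) \<nu>"
    unfolding \<nu>_def using lam_pos by (simp add: ennreal_mult'[symmetric])
  have "prob_space \<nu>"
  proof
    show "emeasure \<nu> (space \<nu>) = 1"
      using lam_pos by (simp add: \<nu>_def space_scale_measure space lam ennreal_mult'[symmetric])
  qed
  then have df: "is_df_of \<nu> H" by (simp add: is_df_of_def H_def \<nu>_def)
  interpret H: planar_distribution \<nu> H by (rule planar_distributionI[OF df])
  have T_open: "T_fun F (a, b) = lam * (1 - H (a, b))" if "fst L < a" "snd L < b" for a b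
  proof -
    have "measure \<tau> (- ({..a} \<times> {..b})) = lam - measure \<tau> ({..a} \<times> {..b})"
      using tau.finite_measure_compl[of "{..a} \<times> {..b}"]
      by (simp add: space lam_def Compl_eq_Diff_UNIV borel_Times)
    moreover have "measure \<tau> ({..a} \<times> {..b}) = lam * H (a, b)"
      using lam_pos by (simp add: H_def \<nu>_def)
    ultimately show ?thesis using T_eq_tau(1)[OF that] by (simp add: algebra_simps)
  qed
  have "T_fun F x = lam * (1 - H x)" if x: "0 < F x" for x
  proof (rule LIMSEQ_unique[OF T_fun_right[OF x]])
    have "T_fun F (up m x) = lam * (1 - H (up m x))" for m
      using T_open[of "fst (up m x)" "snd (up m x)"] up_Quad[OF pos_ge[OF x], of m]
      by (simp add: mem_Times_iff)
    then show "(\<lambda>m. T_fun F (up m x)) \<longlonglongrightarrow> lam * (1 - H x)"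
      by (simp add: tendsto_intros H.right_continuous)
  qed
  then have "T_representation F H lam"
    using lam_pos H.bivariate by (simp add: T_representation_def)
  then show ?thesis using tau_eq H.df_measure by blast
qed

end

text \<open>The sets on the left generate the Borel sets (\<open>borel_eq_greaterThan\<close>), so upper quadrants do.\<close>

lemma eucl_less_planar: "{x :: real \<times> real. eucl_less a x} = {fst a<..} \<times> {snd a<..}"
  by (cases a) (auto simp: eucl_less_def Basis_prod_def)

text \<open>The mass of an upper quadrant inside \<open>Quad\<close> is \<open>1 - Q\<close>. The measures
  are compared on the smaller quadrants above \<open>up m L\<close>: these meet every upper quadrant in an upper
  quadrant of this kind, and they exhaust \<open>Quad\<close>.\<close>

lemma tau_unique:
  assumes tau: "tau_representation F L \<tau>" and tau': "tau_representation F L \<tau>'"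
    and A: "A \<in> sets borel" "A \<subseteq> Quad"
  shows "emeasure \<tau> A = emeasure \<tau>' A"
proof -
  let ?S = "\<lambda>m. {fst (up m L)<..} \<times> {snd (up m L)<..}"
  note [simp] = tau_representationD(1)[OF tau] tau_representationD(1)[OF tau']
  have S[simp]: "{a<..} \<times> {b<..} \<in> sets borel" for a b :: real by (intro borel_Times) auto
  have upper: "emeasure \<tau> ({a<..} \<times> {b<..}) = emeasure \<tau>' ({a<..} \<times> {b<..})"
    "emeasure \<tau> ({a<..} \<times> {b<..}) \<noteq> \<infinity>"
    if "fst L < a" "snd L < b" for a b
  proof -
    have "{a<..} \<times> {b<..} \<in> fmeasurable \<tau>" "{a<..} \<times> {b<..} \<in> fmeasurable \<tau>'"
      using that by (auto intro!: fmeasurable_tau(1)[OF tau] fmeasurable_tau(1)[OF tau'])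
    then have "emeasure \<tau> ({a<..} \<times> {b<..}) = ennreal (measure \<tau> ({a<..} \<times> {b<..}))"
      "emeasure \<tau>' ({a<..} \<times> {b<..}) = ennreal (measure \<tau>' ({a<..} \<times> {b<..}))"
      by (simp_all add: emeasure_eq_measure2)
    moreover have "measure \<tau> ({a<..} \<times> {b<..}) = measure \<tau>' ({a<..} \<times> {b<..})"
      using Q_eq_tau[OF tau that] Q_eq_tau[OF tau' that] by simp
    ultimately show "emeasure \<tau> ({a<..} \<times> {b<..}) = emeasure \<tau>' ({a<..} \<times> {b<..})"
      "emeasure \<tau> ({a<..} \<times> {b<..}) \<noteq> \<infinity>" by simp_all
  qed
  have "density \<tau> (indicator (?S m)) = density \<tau>' (indicator (?S m))" for m
  proof (rule measure_eqI_generator_eq[where \<Omega> = UNIV and E = "range (\<lambda>a. {x :: real \<times> real. eucl_less a x})"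
      and A = "\<lambda>n. {x. eucl_less (- real n, - real n) x}"])
    have em: "emeasure (density \<sigma> (indicator (?S m))) ({a<..} \<times> {b<..}) =
        emeasure \<sigma> ({max (fst (up m L)) a<..} \<times> {max (snd (up m L)) b<..})"
      if "sets \<sigma> = sets borel" for \<sigma> :: "(real \<times> real) measure" and a b
    proof -
      have "?S m \<inter> {a<..} \<times> {b<..} = {max (fst (up m L)) a<..} \<times> {max (snd (up m L)) b<..}" by auto
      then show ?thesis using that by (simp add: emeasure_restricted)
    qed
    have max: "fst L < max (fst (up m L)) a" "snd L < max (snd (up m L)) b" for a b
      using up_ge[of L m] by (auto simp: less_max_iff_disj)
    show "Int_stable (range (\<lambda>a. {x :: real \<times> real. eucl_less a x}))"
    proof (clarsimp simp: Int_stable_def eucl_less_planar)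
      fix a b c d :: real
      have "{a<..} \<times> {b<..} \<inter> {c<..} \<times> {d<..} = {max a c<..} \<times> {max b d<..}" by auto
      then show "{a<..} \<times> {b<..} \<inter> {c<..} \<times> {d<..} \<in> range (\<lambda>a. {fst a<..} \<times> {snd a<..})"
        by (intro image_eqI[of _ _ "(max a c, max b d)"]) simp_all
    qed
    show "emeasure (density \<tau> (indicator (?S m))) X = emeasure (density \<tau>' (indicator (?S m))) X"
      if "X \<in> range (\<lambda>a. {x :: real \<times> real. eucl_less a x})" for X
      using that max by (auto simp: eucl_less_planar em upper(1))
    show "sets (density \<tau> (indicator (?S m))) = sigma_sets UNIV (range (\<lambda>a. {x :: real \<times> real. eucl_less a x}))"
      "sets (density \<tau>' (indicator (?S m))) = sigma_sets UNIV (range (\<lambda>a. {x :: real \<times> real. eucl_less a x}))"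
      by (simp_all add: borel_eq_greaterThan)
    show "emeasure (density \<tau> (indicator (?S m))) {x. eucl_less (- real n, - real n) x} \<noteq> \<infinity>" for n
      using max by (simp add: eucl_less_planar em upper(2)[simplified])
    have "\<exists>n. - real n < a \<and> - real n < b" for a b :: real
      using reals_Archimedean2[of "max (- a) (- b)"] by (auto simp: minus_less_iff)
    then show "(\<Union>n. {x. eucl_less (- real n, - real n) x}) = UNIV" by (auto simp: eucl_less_planar)
  qed auto
  then have restr: "emeasure \<tau> (?S m \<inter> A) = emeasure \<tau>' (?S m \<inter> A)" for m
    using A(1) emeasure_restricted[of "?S m" \<tau> A] emeasure_restricted[of "?S m" \<tau>' A] by simp
  have inc: "incseq (\<lambda>m. ?S m \<inter> A)"
    using up_antimono[of _ _ L] by (auto simp: incseq_def less_eq_prod_def intro: le_less_trans)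
  have "A = (\<Union>m. ?S m \<inter> A)"
  proof
    show "A \<subseteq> (\<Union>m. ?S m \<inter> A)"
    proof
      fix z assume z: "z \<in> A"
      then have "fst L < fst z" "snd L < snd z" using A(2) by auto
      then have "\<forall>\<^sub>F m in sequentially. fst L + inverse (real (Suc m)) < fst z"
        "\<forall>\<^sub>F m in sequentially. snd L + inverse (real (Suc m)) < snd z"
        by (auto intro: order_tendstoD(2)[OF inverse_Suc_lim] simp del: of_nat_Suc)
      then have "\<forall>\<^sub>F m in sequentially. z \<in> ?S m"
        by eventually_elim (simp add: up_def mem_Times_iff)
      then show "z \<in> (\<Union>m. ?S m \<inter> A)"
        using z eventually_happens'[OF sequentially_bot] by blast
    qed
  qed auto
  moreover have "(SUP m. emeasure \<tau> (?S m \<inter> A)) = emeasure \<tau> (\<Union>m. ?S m \<inter> A)"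
    "(SUP m. emeasure \<tau>' (?S m \<inter> A)) = emeasure \<tau>' (\<Union>m. ?S m \<inter> A)"
    using A(1) by (intro SUP_emeasure_incseq[OF _ inc]; auto)+
  ultimately show ?thesis using restr by simp
qed

end

theorem theorem4p3:
  fixes F :: "real \<times> real \<Rightarrow> real" and L :: "real \<times> real"
  assumes "bivariate_df F"
    and "\<not> (\<exists>c. AE z in df_measure F. z = c)"
    and "generalized_rectangle L {x. 0 < F x}"
  shows
    "(bifree_max_inf_div F \<longleftrightarrow>
        quasi_monotone_on {x. 0 < F x} (\<lambda>x. - Q_fun F x) \<and>
        (\<forall>x y. 0 < F x \<and> 0 < F y \<and> x \<le> y \<longrightarrow>
           0 \<le> Q_fun F y - Q_fun F x \<and>
           Q_fun F y - Q_fun F x \<le> marginal1 F (fst y) - marginal1 F (fst x)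
                            + marginal2 F (snd y) - marginal2 F (snd x))) \<and>
     (bifree_max_inf_div F \<longleftrightarrow>
        mono_on {x. 0 < F x} (\<lambda>x. - T_fun F x) \<and>
        continuous_from_above_on {x. 0 < F x} (\<lambda>x. - T_fun F x) \<and>
        quasi_monotone_on {x. 0 < F x} (\<lambda>x. - T_fun F x)) \<and>
     (bifree_max_inf_div F \<longleftrightarrow> (\<exists>H lam. T_representation F H lam)) \<and>
     (bifree_max_inf_div F \<longleftrightarrow> (\<exists>\<tau>. tau_representation F L \<tau>)) \<and>
     (\<forall>H lam. T_representation F H lam \<longrightarrow>
        tau_representation F L (scale_measure (ennreal lam) (df_measure H))) \<and>
     (\<forall>\<tau>. tau_representation F L \<tau> \<and> emeasure \<tau> UNIV < \<infinity> \<longrightarrow>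
        (\<exists>H lam. T_representation F H lam \<and> \<tau> = scale_measure (ennreal lam) (df_measure H))) \<and>
     (\<forall>H lam \<tau>. T_representation F H lam \<and> tau_representation F L \<tau> \<longrightarrow>
        (\<forall>A \<in> sets borel. A \<subseteq> {fst L<..} \<times> {snd L<..} \<longrightarrow>
           emeasure \<tau> A = emeasure (scale_measure (ennreal lam) (df_measure H)) A) \<and>
        (emeasure \<tau> UNIV = ennreal lam \<and>
         emeasure \<tau> (- ({fst L..} \<times> {snd L..})) = 0 \<and>
         emeasure (df_measure H) (- ({fst L..} \<times> {snd L..})) = 0 \<longrightarrow>
           \<tau> = scale_measure (ennreal lam) (df_measure H))) \<and>
     (\<forall>H lam. T_representation F H lam \<longrightarrow>
        (\<exists>T'. (\<forall>x. 0 < F x \<longrightarrow> T' x = T_fun F x) \<and>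
              (\<forall>x \<in> {fst L..} \<times> {snd L..}. T' x = lam * (1 - H x)) \<and>
              0 < T' L \<and> T' L \<le> lam))"
proof -
  interpret rectangular_distribution "df_measure F" F L
    using planar_distribution_df_measure[OF assms(1)] assms(3)
    by (simp add: rectangular_distribution_def rectangular_distribution_axioms_def)
  let ?C1 = "bifree_max_inf_div F"
  let ?C2 = "quasi_monotone_on {x. 0 < F x} (\<lambda>x. - Q_fun F x) \<and>
        (\<forall>x y. 0 < F x \<and> 0 < F y \<and> x \<le> y \<longrightarrow>
           0 \<le> Q_fun F y - Q_fun F x \<and>
           Q_fun F y - Q_fun F x \<le> marginal1 F (fst y) - marginal1 F (fst x)
                            + marginal2 F (snd y) - marginal2 F (snd x))"
  let ?C3 = "mono_on {x. 0 < F x} (\<lambda>x. - T_fun F x) \<and>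
        continuous_from_above_on {x. 0 < F x} (\<lambda>x. - T_fun F x) \<and>
        quasi_monotone_on {x. 0 < F x} (\<lambda>x. - T_fun F x)"
  let ?C4 = "\<exists>H lam. T_representation F H lam"
  let ?C5 = "\<exists>\<tau>. tau_representation F L \<tau>"
  let ?M = "mono_on Quad (\<lambda>x. - T_fun F x) \<and> quasi_monotone_on Quad (\<lambda>x. - T_fun F x)"
  \<comment> \<open>All implications pass through \<open>?M\<close>, which involves only the open quadrant.\<close>
  have restrict: ?M if "mono_on {x. 0 < F x} (\<lambda>x. - T_fun F x)"
    "quasi_monotone_on {x. 0 < F x} (\<lambda>x. - T_fun F x)"
    using that Quad_subset by (auto intro: mono_on_subset simp: quasi_monotone_on_def)
  have C14: ?C4 if ?M
    using T_representation_exists that by blast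
  have "?M" if ?C1 using inf_div_imp_T_monotone[OF that] by (rule restrict)
  moreover have "?M" if C: ?C2
  proof (rule restrict)
    show "mono_on {x. 0 < F x} (\<lambda>x. - T_fun F x)"
    proof (rule mono_onI)
      fix x y assume "x \<in> {x. 0 < F x}" "y \<in> {x. 0 < F x}" "x \<le> y"
      then have "Q_fun F y - Q_fun F x \<le> marginal1 F (fst y) - marginal1 F (fst x)
                            + marginal2 F (snd y) - marginal2 F (snd x)" using C by blast
      then show "- T_fun F x \<le> - T_fun F y" by (simp add: T_fun_def Q_fun_def)
    qed
    show "quasi_monotone_on {x. 0 < F x} (\<lambda>x. - T_fun F x)"
      using C unfolding quasi_monotone_on_def T_fun_def Q_fun_def by (simp add: algebra_simps)
  qed
  moreover have "?M" if ?C3 using that restrict by blast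
  moreover have "?M" if ?C5 using that tau_imp_T_monotone by blast
  moreover have "?C1 \<and> ?C2 \<and> ?C3 \<and> ?C5" if rep: ?C4
  proof -
    obtain H lam where "T_representation F H lam" using rep by blast
    then interpret represented_distribution "df_measure F" F L "df_measure H" H lam
      by (rule represented_distributionI)
    show ?thesis
      using bifree_max_inf_div Q_conditions T_conditions tau_representation_scaled by blast
  qed
  ultimately have equiv: "?C1 \<longleftrightarrow> ?C2" "?C1 \<longleftrightarrow> ?C3" "?C1 \<longleftrightarrow> ?C4" "?C1 \<longleftrightarrow> ?C5"
    using C14 by argo+
  have scaled: "tau_representation F L (scale_measure (ennreal lam) (df_measure H))"
    if "T_representation F H lam" for H lam
    by (rule represented_distribution.tau_representation_scaled[OF represented_distributionI[OF that]])
  have ext: "0 < lam * (1 - H L) \<and> lam * (1 - H L) \<le> lam" if rep: "T_representation F H lam" for H lam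
  proof -
    interpret represented_distribution "df_measure F" F L "df_measure H" H lam
      by (rule represented_distributionI[OF rep])
    show ?thesis using df_corner_less_1[OF assms(2)] lam_pos H.nonneg[of L] by simp
  qed
  have unique: "\<tau> = scale_measure (ennreal lam) (df_measure H)"
    if rep: "T_representation F H lam" and tau: "tau_representation F L \<tau>"
      and total: "emeasure \<tau> UNIV = ennreal lam"
      and null: "emeasure \<tau> (- ({fst L..} \<times> {snd L..})) = 0"
        "emeasure (df_measure H) (- ({fst L..} \<times> {snd L..})) = 0" for H lam \<tau>
  proof -
    interpret A: represented_distribution "df_measure F" F L "df_measure H" H lam
      by (rule represented_distributionI[OF rep])
    \<comment> \<open>A second representation, by the normalized \<open>\<tau>\<close>, has the same total mass. Both distribution functions
      agree where \<open>T\<close> determines them, on its boundary by right continuity, and vanish elsewhere.\<close>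
    obtain H' lam' where H': "T_representation F H' lam'" "\<tau> = scale_measure (ennreal lam') (df_measure H')"
      using finite_tau_imp_T_representation[OF tau] total by auto
    interpret B: represented_distribution "df_measure F" F L "df_measure H'" H' lam'
      by (rule represented_distributionI[OF H'(1)])
    have "lam' = lam"
    proof -
      have "emeasure \<tau> UNIV = ennreal lam'"
        unfolding H'(2) emeasure_scale_measure using B.H.emeasure_space_1 unfolding B.H.space_mu by simp
      then have "ennreal lam' = ennreal lam" using total by simp
      then show ?thesis using A.lam_pos B.lam_pos by (subst (asm) ennreal_inj) auto
    qed
    have null': "emeasure (df_measure H') (- ({fst L..} \<times> {snd L..})) = 0"
      using null(1) B.lam_pos unfolding H'(2) emeasure_scale_measure by simp
    have "H x = H' x" for x
    proof (cases "L \<le> x")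
      case True
      have "H (up m x) = H' (up m x)" for m
      proof -
        have "0 < F (up m x)" using Quad_subset up_Quad[OF True] by blast
        then have "lam * (1 - H (up m x)) = lam * (1 - H' (up m x))"
          using A.T_eq B.T_eq \<open>lam' = lam\<close> by metis
        then show ?thesis using A.lam_pos by simp
      qed
      then show ?thesis
        using LIMSEQ_unique[OF A.H.right_continuous[of x]] B.H.right_continuous[of x] by simp
    next
      case False
      then have "{..fst x} \<times> {..snd x} \<subseteq> - ({fst L..} \<times> {snd L..})"
        by (auto simp: less_eq_prod_def)
      moreover have "- ({fst L..} \<times> {snd L..}) \<in> sets (borel :: (real \<times> real) measure)"
        by (intro borel_comp borel_Times) auto
      ultimately have "emeasure (df_measure H) ({..fst x} \<times> {..snd x}) = 0"
        "emeasure (df_measure H') ({..fst x} \<times> {..snd x}) = 0"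
        using null(2) null' emeasure_mono[of "{..fst x} \<times> {..snd x}" "- ({fst L..} \<times> {snd L..})"]
        by (metis A.H.sets_mu B.H.sets_mu le_zero_eq)+
      then show ?thesis
        using A.H.F_eq[of "fst x" "snd x"] B.H.F_eq[of "fst x" "snd x"] by (simp add: measure_def)
    qed
    then have "H' = H" by auto
    then show ?thesis using H'(2) \<open>lam' = lam\<close> by simp
  qed
  have last: "\<exists>T'. (\<forall>x. 0 < F x \<longrightarrow> T' x = T_fun F x) \<and>
              (\<forall>x \<in> {fst L..} \<times> {snd L..}. T' x = lam * (1 - H x)) \<and>
              0 < T' L \<and> T' L \<le> lam" if rep: "T_representation F H lam" for H lam
    using ext[OF rep] rep
    by (intro exI[of _ "\<lambda>x. lam * (1 - H x)"]) (simp add: T_representation_def)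
  show ?thesis
  proof (intro conjI)
    show "\<forall>\<tau>. tau_representation F L \<tau> \<and> emeasure \<tau> UNIV < \<infinity> \<longrightarrow>
        (\<exists>H lam. T_representation F H lam \<and> \<tau> = scale_measure (ennreal lam) (df_measure H))"
      using finite_tau_imp_T_representation by blast
    show "\<forall>H lam \<tau>. T_representation F H lam \<and> tau_representation F L \<tau> \<longrightarrow>
        (\<forall>A \<in> sets borel. A \<subseteq> {fst L<..} \<times> {snd L<..} \<longrightarrow>
           emeasure \<tau> A = emeasure (scale_measure (ennreal lam) (df_measure H)) A) \<and>
        (emeasure \<tau> UNIV = ennreal lam \<and>
         emeasure \<tau> (- ({fst L..} \<times> {snd L..})) = 0 \<and>
         emeasure (df_measure H) (- ({fst L..} \<times> {snd L..})) = 0 \<longrightarrow>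
           \<tau> = scale_measure (ennreal lam) (df_measure H))"
      using tau_unique[OF _ scaled] unique by blast
  qed (use equiv scaled last in blast)+
qed

end
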